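(* Let $n,d_0,d_1,d_2$ be positive integers, $X\in\mathbb{R}^{n\times d_0}$, $W_1\in\mathbb{R}^{d_1\times d_0}$, $W_2\in\mathbb{R}^{d_2\times d_1}$, and let $\frac1n JJ^\top\in\mathbb{R}^{d_2n\times d_2n}$ be the NTK matrix of the shallow ($L=2$) linear network $x\mapsto xW_1^\top W_2^\top$ on the inputs $X$. Then the non-zero eigenvalues of $\frac1n JJ^\top$ are characterized by the pairwise sums of squared singular values of the two layers: the eigenvalues of $\frac1n JJ^\top$, counted with multiplicity and up to additional zero eigenvalues, can be indexed as $\lambda_{ij}\left(\frac1n JJ^\top\right)$ with $i\in\{1,\dots,\min\{d_0,d_1\}\}$ and $j\in\{1,\dots,\min\{d_1,d_2\}\}$ in such a way that $$\lambda_{ij}\left(\tfrac1n JJ^\top\right)\le \frac{\|X\|_2^2}{n}\left(\sigma_i^2(W_1)+\sigma_j^2(W_2)\right)\quad\text{for all } i,j.$$ Furthermore, if $n\ge d_0$, $X$ has rank $d_0$, and all $d_0$ singular values of $X$ are equal, then the bound is attained, i.e. equality holds for all $i,j$.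
   Context: $\sigma_i(W)$ denotes the $i$-th largest singular value of $W$; $\|\cdot\|_2$ is the spectral norm; $\otimes$ is the Kronecker product. The rows of $X$ are the inputs $x_1,\dots,x_n\in\mathbb{R}^{1\times d_0}$. $J$ is the Jacobian of the predictions $XW_1^\top W_2^\top$ with respect to all weights $(W_1,W_2)$, written in block form as $J=[J_1\ J_2]$ with $J_1=W_2\otimes X$ and $J_2=I_{d_2}\otimes (XW_1^\top)$, so that $$\tfrac1n JJ^\top=(W_2W_2^\top)\otimes\left(\tfrac1n XX^\top\right)+I_{d_2}\otimes\left(\tfrac1n XW_1^\top W_1X^\top\right).$$ This matrix is called the Neural Tangent Kernel (NTK) matrix.
   Formalization: Stated index set can be too small (n=d0=d1=1, d2=2, X=W1=(1), W2=(1,0)^T: eigenvalues 2,1, one pair). Proved with i≤d0, j≤d2 (singular values past the min are 0) in all dimensions, and with the stated set when min(n,d0)≤d1 and d2≤d1. *)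

theory Defs
  imports
    Complex_Main
    "Jordan_Normal_Form.Char_Poly"
    "Jordan_Normal_Form.DL_Rank"
begin

section \<open>Kronecker product\<close>

definition kronecker :: "real mat \<Rightarrow> real mat \<Rightarrow> real mat" (infixl \<open>\<otimes>\<^sub>K\<close> 70) where
  "A \<otimes>\<^sub>K B = mat (dim_row A * dim_row B) (dim_col A * dim_col B)
     (\<lambda>(r, c). A $$ (r div dim_row B, c div dim_col B) * B $$ (r mod dim_row B, c mod dim_col B))"

lemma kronecker_carrier [simp, intro]:
  "A \<in> carrier_mat a b \<Longrightarrow> B \<in> carrier_mat c d \<Longrightarrow> A \<otimes>\<^sub>K B \<in> carrier_mat (a * c) (b * d)"
  by (auto simp: kronecker_def)

lemma dim_kronecker [simp]:
  "dim_row (A \<otimes>\<^sub>K B) = dim_row A * dim_row B" "dim_col (A \<otimes>\<^sub>K B) = dim_col A * dim_col B"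
  by (auto simp: kronecker_def)

lemma block_index_less:
  fixes i j a b :: nat
  assumes "i < a" "j < b"
  shows "i * b + j < a * b"
proof -
  have "i * b + j < Suc i * b" using assms by simp
  also have "\<dots> \<le> a * b" using assms by (intro mult_right_mono) auto
  finally show ?thesis .
qed

lemma kronecker_index:
  assumes "i < dim_row A" "k < dim_row B" "j < dim_col A" "l < dim_col B"
  shows "(A \<otimes>\<^sub>K B) $$ (i * dim_row B + k, j * dim_col B + l) = A $$ (i, j) * B $$ (k, l)"
  using assms by (simp add: kronecker_def block_index_less)

section \<open>Eigenvalues, singular values, spectral norm\<close>

text \<open>The multiset of real eigenvalues with algebraic multiplicity.  It is only used for symmetric
  matrices, which have no other eigenvalues.\<close>

definition eigenvalues :: "real mat \<Rightarrow> real multiset" where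
  "eigenvalues A = proots (char_poly A)"

lemma set_eigenvalues:
  assumes A: "A \<in> carrier_mat n n"
  shows "set_mset (eigenvalues A) = {e. eigenvalue A e}"
proof -
  have "char_poly A \<noteq> 0"
    using degree_monic_char_poly[OF A] by auto
  then show ?thesis
    by (simp add: eigenvalues_def eigenvalue_root_char_poly[OF A])
qed

text \<open>The family \<open>lam\<close> over \<open>I\<close> lists the eigenvalues with multiplicity, up to the number of
  zeros.\<close>

definition eigenvalues_indexed_by :: "real mat \<Rightarrow> ('i \<Rightarrow> real) \<Rightarrow> 'i set \<Rightarrow> bool" where
  "eigenvalues_indexed_by A lam I \<longleftrightarrow>
     finite I \<and> {#e \<in># eigenvalues A. e \<noteq> 0#} = {#e \<in># image_mset lam (mset_set I). e \<noteq> 0#}"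

text \<open>The \<open>i\<close>-th largest singular value (\<open>i \<ge> 1\<close>), counted with multiplicity.  The Gram matrix
  \<open>W\<^sup>T W\<close> has \<open>dim_col W\<close> eigenvalues; for a wide \<open>W\<close> the surplus ones are zero and come last.
  Beyond \<open>min (dim_row W) (dim_col W)\<close> we use the convention \<open>\<sigma>\<^sub>i(W) = 0\<close>.\<close>

definition singular_value :: "nat \<Rightarrow> real mat \<Rightarrow> real" where
  "singular_value i W =
     (if 1 \<le> i \<and> i \<le> min (dim_row W) (dim_col W)
      then rev (sorted_list_of_multiset
             (image_mset sqrt (eigenvalues (transpose_mat W * W)))) ! (i - 1)
      else 0)"

definition euclidean_norm :: "real vec \<Rightarrow> real" where
  "euclidean_norm v = sqrt (v \<bullet> v)"

definition spectral_norm :: "real mat \<Rightarrow> real" where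
  "spectral_norm A =
     (SUP v \<in> {v \<in> carrier_vec (dim_col A). euclidean_norm v \<le> 1}. euclidean_norm (A *\<^sub>v v))"

section \<open>The shallow linear network and its NTK\<close>

text \<open>The rows of \<open>X\<close> are the inputs.\<close>

definition shallow_net :: "real mat \<Rightarrow> real mat \<Rightarrow> real mat \<Rightarrow> real mat" where
  "shallow_net X W1 W2 = X * transpose_mat W1 * transpose_mat W2"

definition append_cols :: "real mat \<Rightarrow> real mat \<Rightarrow> real mat" where
  "append_cols A B = four_block_mat A B (0\<^sub>m 0 (dim_col A)) (0\<^sub>m 0 (dim_col B))"

text \<open>Row \<open>a * n + k\<close> belongs to output \<open>a\<close> on input \<open>k\<close>.  The columns list the entries of \<open>W1\<close>
  row by row, followed by those of \<open>W2\<close> row by row.  See \<open>net_jacobian_W1\<close> and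
  \<open>net_jacobian_W2\<close> below.\<close>

definition net_jacobian :: "real mat \<Rightarrow> real mat \<Rightarrow> real mat \<Rightarrow> real mat" where
  "net_jacobian X W1 W2 =
     append_cols (W2 \<otimes>\<^sub>K X) (1\<^sub>m (dim_row W2) \<otimes>\<^sub>K (X * transpose_mat W1))"

definition ntk :: "real mat \<Rightarrow> real mat \<Rightarrow> real mat \<Rightarrow> real mat" where
  "ntk X W1 W2 =
     (1 / real (dim_row X)) \<cdot>\<^sub>m (net_jacobian X W1 W2 * transpose_mat (net_jacobian X W1 W2))"

definition set_entry :: "real mat \<Rightarrow> nat \<Rightarrow> nat \<Rightarrow> real \<Rightarrow> real mat" where
  "set_entry W b l t =
     mat (dim_row W) (dim_col W) (\<lambda>ix. if ix = (b, l) then t else W $$ ix)"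

context
  fixes n d0 d1 d2 :: nat and X W1 W2 :: "real mat"
  assumes X: "X \<in> carrier_mat n d0"
    and W1: "W1 \<in> carrier_mat d1 d0"
    and W2: "W2 \<in> carrier_mat d2 d1"
begin

lemma net_jacobian_carrier: "net_jacobian X W1 W2 \<in> carrier_mat (d2 * n) (d1 * d0 + d2 * d1)"
  using X W1 W2 by (auto simp: net_jacobian_def append_cols_def)

lemma ntk_carrier: "ntk X W1 W2 \<in> carrier_mat (d2 * n) (d2 * n)"
  using net_jacobian_carrier by (auto simp: ntk_def)

lemma shallow_net_index:
  assumes "V1 \<in> carrier_mat d1 d0" "V2 \<in> carrier_mat d2 d1" "k < n" "a < d2"
  shows "shallow_net X V1 V2 $$ (k, a) =
    (\<Sum>c<d1. (\<Sum>m<d0. X $$ (k, m) * V1 $$ (c, m)) * V2 $$ (a, c))"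
proof -
  define M where "M = X * transpose_mat V1"
  have "M \<in> carrier_mat n d1" using assms X by (auto simp: M_def)
  then have "(M * transpose_mat V2) $$ (k, a) = (\<Sum>c<d1. M $$ (k, c) * V2 $$ (a, c))"
    using assms by (auto simp: scalar_prod_def atLeast0LessThan intro!: sum.cong)
  moreover have "M $$ (k, c) = (\<Sum>m<d0. X $$ (k, m) * V1 $$ (c, m))" if "c < d1" for c
    using assms X that by (auto simp: M_def scalar_prod_def atLeast0LessThan intro!: sum.cong)
  ultimately show ?thesis by (simp add: shallow_net_def M_def)
qed

lemma net_jacobian_W1:
  assumes "k < n" "a < d2" "b < d1" "l < d0"
  shows "((\<lambda>t. shallow_net X (set_entry W1 b l t) W2 $$ (k, a))
    has_real_derivative net_jacobian X W1 W2 $$ (a * n + k, b * d0 + l)) (at (W1 $$ (b, l)))"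
proof -
  have "a * n + k < d2 * n" "b * d0 + l < d1 * d0"
    using assms by (auto intro: block_index_less)
  then have J: "net_jacobian X W1 W2 $$ (a * n + k, b * d0 + l) = W2 $$ (a, b) * X $$ (k, l)"
    using kronecker_index[of a W2 k X b l] assms X W1 W2
    by (auto simp: net_jacobian_def append_cols_def)
  have "set_entry W1 b l t \<in> carrier_mat d1 d0" for t
    using W1 by (auto simp: set_entry_def)
  then have "shallow_net X (set_entry W1 b l t) W2 $$ (k, a) =
      (\<Sum>c<d1. (\<Sum>m<d0. X $$ (k, m) * (if c = b \<and> m = l then t else W1 $$ (c, m))) * W2 $$ (a, c))" for t
    using assms W1 W2 by (subst shallow_net_index) (auto simp: set_entry_def)
  moreover have "((\<lambda>t. \<Sum>c<d1. (\<Sum>m<d0. X $$ (k, m) * (if c = b \<and> m = l then t else W1 $$ (c, m))) * W2 $$ (a, c))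
      has_real_derivative
      (\<Sum>c<d1. (\<Sum>m<d0. X $$ (k, m) * (if c = b \<and> m = l then 1 else 0)) * W2 $$ (a, c))) (at (W1 $$ (b, l)))"
    by (rule DERIV_sum, rule DERIV_cmult_right, rule DERIV_sum, rule DERIV_cmult) auto
  moreover have "(\<Sum>c<d1. (\<Sum>m<d0. X $$ (k, m) * (if c = b \<and> m = l then 1 else 0)) * W2 $$ (a, c))
      = (\<Sum>c<d1. if c = b then X $$ (k, l) * W2 $$ (a, b) else 0)"
    using assms by (intro sum.cong) (auto simp: if_distrib cong: if_cong)
  ultimately show ?thesis using assms J by (simp add: mult.commute)
qed

lemma net_jacobian_W2:
  assumes "k < n" "a < d2" "a' < d2" "b < d1"
  shows "((\<lambda>t. shallow_net X W1 (set_entry W2 a' b t) $$ (k, a))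
    has_real_derivative net_jacobian X W1 W2 $$ (a * n + k, d1 * d0 + (a' * d1 + b)))
      (at (W2 $$ (a', b)))"
proof -
  have "a * n + k < d2 * n" "a' * d1 + b < d2 * d1"
    using assms by (auto intro: block_index_less)
  then have J: "net_jacobian X W1 W2 $$ (a * n + k, d1 * d0 + (a' * d1 + b)) =
      (if a = a' then \<Sum>m<d0. X $$ (k, m) * W1 $$ (b, m) else 0)"
    using kronecker_index[of a "1\<^sub>m d2" k "X * transpose_mat W1" a' b] assms X W1 W2
    by (auto simp: net_jacobian_def append_cols_def scalar_prod_def atLeast0LessThan
        intro!: sum.cong)
  have "set_entry W2 a' b t \<in> carrier_mat d2 d1" for t
    using W2 by (auto simp: set_entry_def)
  then have "shallow_net X W1 (set_entry W2 a' b t) $$ (k, a) =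
      (\<Sum>c<d1. (\<Sum>m<d0. X $$ (k, m) * W1 $$ (c, m)) * (if a = a' \<and> c = b then t else W2 $$ (a, c)))" for t
    using assms W1 W2 by (subst shallow_net_index) (auto simp: set_entry_def)
  moreover have "((\<lambda>t. \<Sum>c<d1. (\<Sum>m<d0. X $$ (k, m) * W1 $$ (c, m)) * (if a = a' \<and> c = b then t else W2 $$ (a, c)))
      has_real_derivative
      (\<Sum>c<d1. (\<Sum>m<d0. X $$ (k, m) * W1 $$ (c, m)) * (if a = a' \<and> c = b then 1 else 0))) (at (W2 $$ (a', b)))"
    by (rule DERIV_sum, rule DERIV_cmult) auto
  moreover have "(\<Sum>c<d1. (\<Sum>m<d0. X $$ (k, m) * W1 $$ (c, m)) * (if a = a' \<and> c = b then 1 else 0))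
      = (\<Sum>c<d1. if c = b then (if a = a' then \<Sum>m<d0. X $$ (k, m) * W1 $$ (b, m) else 0) else 0)"
    by (intro sum.cong) auto
  ultimately show ?thesis using assms J by simp
qed

end

end

theory Submission
  imports Defs "HOL-Combinatorics.List_Permutation"
begin

text \<open>Write \<open>s\<^sub>j\<close> for the eigenvalues of \<open>W2 W2\<^sup>T\<close>, with orthonormal eigenvectors \<open>u\<^sub>j\<close>.  On the vectors
  \<open>u\<^sub>j \<otimes> v\<close> the NTK acts as \<open>u\<^sub>j \<otimes> B\<^sub>j v\<close> with
  \<open>B\<^sub>j = (X (s\<^sub>j + W1\<^sup>T W1) X\<^sup>T) / n\<close>, so its spectrum is the union of the spectra of the \<open>B\<^sub>j\<close>, and
  \<open>lam i j\<close> is taken to be the \<open>i\<close>-th largest eigenvalue of \<open>B\<^sub>j\<close> (or \<open>0\<close> for \<open>i > n\<close>).  The minimax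
  principle bounds it by \<open>\<parallel>X\<parallel>\<^sup>2 / n\<close> times the \<open>i\<close>-th largest eigenvalue of \<open>s\<^sub>j + W1\<^sup>T W1\<close>, since
  \<open>X\<^sup>T\<close> stretches vectors by at most \<open>\<parallel>X\<parallel>\<close>.  If all singular values of \<open>X\<close> are equal, then \<open>X\<^sup>T X\<close> is
  the scalar \<open>\<parallel>X\<parallel>\<^sup>2\<close>, and the same argument with \<open>X\<close> in place of \<open>X\<^sup>T\<close> gives the reverse
  inequality.\<close>

section \<open>Symmetric matrices and reflections\<close>

lemma scalar_prod_self_nonneg: "0 \<le> v \<bullet> (v :: real vec)"
  by (auto simp: scalar_prod_def intro!: sum_nonneg)

lemma scalar_prod_self_eq_0: "v \<in> carrier_vec n \<Longrightarrow> v \<bullet> v = 0 \<longleftrightarrow> v = 0\<^sub>v n" for v :: "real vec"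
  by (auto simp: scalar_prod_def sum_nonneg_eq_0_iff)

lemma scalar_prod_self_pos: "v \<in> carrier_vec n \<Longrightarrow> v \<noteq> 0\<^sub>v n \<Longrightarrow> 0 < v \<bullet> v" for v :: "real vec"
  using scalar_prod_self_nonneg[of v] scalar_prod_self_eq_0[of v n] by auto

text \<open>Expanding the squared length of \<open>q x - p y\<close> gives
  \<open>q * (q * (x \<bullet> x) - p\<^sup>2)\<close>; dividing by the positive \<open>q\<close>
  leaves the claim.\<close>

lemma Cauchy_Schwarz_vec:
  fixes x y :: "real vec"
  assumes x: "x \<in> carrier_vec n" and y: "y \<in> carrier_vec n"
  shows "(x \<bullet> y)\<^sup>2 \<le> (x \<bullet> x) * (y \<bullet> y)"
proof (cases "y = 0\<^sub>v n")
  case True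
  then show ?thesis using x by simp
next
  case False
  define p q where "p = x \<bullet> y" and "q = y \<bullet> y"
  have q: "0 < q" using scalar_prod_self_pos[OF y False] by (simp add: q_def)
  have yx: "y \<bullet> x = p" using comm_scalar_prod[OF y x] by (simp add: p_def)
  have "0 \<le> (q \<cdot>\<^sub>v x - p \<cdot>\<^sub>v y) \<bullet> (q \<cdot>\<^sub>v x - p \<cdot>\<^sub>v y)"
    by (rule scalar_prod_self_nonneg)
  also have "\<dots> = q * (q * (x \<bullet> x) - p\<^sup>2)"
    using x y yx
    by (simp add: minus_scalar_prod_distrib[of _ n] scalar_prod_minus_distrib[of _ n]
        p_def[symmetric] q_def[symmetric] algebra_simps power2_eq_square)
  finally have "0 \<le> q * (x \<bullet> x) - p\<^sup>2"
    using q by (simp add: zero_le_mult_iff)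
  then show ?thesis by (simp add: p_def q_def mult.commute)
qed

lemma mult_mat_vec_scalar_prod:
  fixes A :: "real mat"
  assumes "A \<in> carrier_mat n m" "x \<in> carrier_vec m" "y \<in> carrier_vec m"
  shows "(A *\<^sub>v x) \<bullet> (A *\<^sub>v y) = x \<bullet> (transpose_mat A *\<^sub>v (A *\<^sub>v y))"
  using assms transpose_vec_mult_scalar[of "transpose_mat A" m n "A *\<^sub>v y" x] by simp

lemma symmetric_scalar_prod:
  fixes A :: "real mat"
  assumes "A \<in> carrier_mat n n" "transpose_mat A = A" "x \<in> carrier_vec n" "y \<in> carrier_vec n"
  shows "(A *\<^sub>v x) \<bullet> y = x \<bullet> (A *\<^sub>v y)"
  using assms transpose_vec_mult_scalar[of A n n y x] by simp

text \<open>The characteristic polynomial has a complex root \<open>l = a + i b\<close> with an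
  eigenvector \<open>x + i y\<close>. Symmetry forces \<open>b = 0\<close>, so \<open>x\<close> and
  \<open>y\<close> both satisfy the eigenvector equation for \<open>a\<close>, and one of them is
  non-zero.\<close>

lemma symmetric_real_eigenvector:
  fixes A :: "real mat"
  assumes A: "A \<in> carrier_mat n n" and sym: "transpose_mat A = A" and n: "0 < n"
  obtains v e where "v \<in> carrier_vec n" "v \<bullet> v = 1" "A *\<^sub>v v = e \<cdot>\<^sub>v v"
proof -
  define C where "C = map_mat complex_of_real A"
  have C: "C \<in> carrier_mat n n" using A by (simp add: C_def)
  obtain l where "poly (char_poly C) l = 0"
    using fundamental_theorem_of_algebra[of "char_poly C"] degree_monic_char_poly[OF C] n
      constant_degree by (metis less_irrefl)
  then have "eigenvalue C l" using eigenvalue_root_char_poly[OF C] by simp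
  then obtain z where z: "z \<in> carrier_vec n" "z \<noteq> 0\<^sub>v n" "C *\<^sub>v z = l \<cdot>\<^sub>v z"
    using C by (auto simp: eigenvalue_def eigenvector_def)
  define x y a b where "x = map_vec Re z" and "y = map_vec Im z" and "a = Re l" and "b = Im l"
  have x: "x \<in> carrier_vec n" and y: "y \<in> carrier_vec n"
    using z by (auto simp: x_def y_def)
  have Cz: "(C *\<^sub>v z) $ i = l * z $ i" if "i < n" for i
    using z that by simp
  have Ax: "A *\<^sub>v x = a \<cdot>\<^sub>v x - b \<cdot>\<^sub>v y"
  proof (rule eq_vecI)
    fix i assume "i < dim_vec (a \<cdot>\<^sub>v x - b \<cdot>\<^sub>v y)"
    then have i: "i < n" using y by simp
    have "(A *\<^sub>v x) $ i = Re ((C *\<^sub>v z) $ i)"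
      using A z(1) i by (auto simp: C_def x_def scalar_prod_def intro!: sum.cong)
    then show "(A *\<^sub>v x) $ i = (a \<cdot>\<^sub>v x - b \<cdot>\<^sub>v y) $ i"
      using Cz[OF i] z(1) i by (simp add: x_def y_def a_def b_def)
  qed (use A y in auto)
  have Ay: "A *\<^sub>v y = a \<cdot>\<^sub>v y + b \<cdot>\<^sub>v x"
  proof (rule eq_vecI)
    fix i assume "i < dim_vec (a \<cdot>\<^sub>v y + b \<cdot>\<^sub>v x)"
    then have i: "i < n" using x by simp
    have "(A *\<^sub>v y) $ i = Im ((C *\<^sub>v z) $ i)"
      using A z(1) i by (auto simp: C_def y_def scalar_prod_def intro!: sum.cong)
    then show "(A *\<^sub>v y) $ i = (a \<cdot>\<^sub>v y + b \<cdot>\<^sub>v x) $ i"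
      using Cz[OF i] z(1) i by (simp add: x_def y_def a_def b_def)
  qed (use A x in auto)
  have "\<exists>w. w \<in> carrier_vec n \<and> w \<noteq> 0\<^sub>v n \<and> A *\<^sub>v w = a \<cdot>\<^sub>v w"
  proof -
    have xy: "x \<noteq> 0\<^sub>v n \<or> y \<noteq> 0\<^sub>v n"
    proof (rule ccontr)
      assume "\<not> ?thesis"
      then have 0: "x = 0\<^sub>v n" "y = 0\<^sub>v n" by auto
      have "z $ i = 0" if "i < n" for i
      proof -
        have "x $ i = 0" "y $ i = 0" using that 0 by auto
        then show ?thesis using that z(1) by (simp add: x_def y_def complex_eq_iff)
      qed
      then have "z = 0\<^sub>v n" using z(1) by (intro eq_vecI) auto
      with z(2) show False by simp
    qed
    \<comment> \<open>The left side contributes \<open>- b * (y \<bullet> y)\<close> and the right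
      side \<open>b * (x \<bullet> x)\<close>, while the terms with \<open>a\<close> agree.\<close>
    have "(A *\<^sub>v x) \<bullet> y = x \<bullet> (A *\<^sub>v y)" by (rule symmetric_scalar_prod[OF A sym x y])
    then have "b * (x \<bullet> x + y \<bullet> y) = 0"
      using x y by (simp add: Ax Ay minus_scalar_prod_distrib[of _ n] scalar_prod_add_distrib[of _ n]
          algebra_simps)
    moreover have "0 < x \<bullet> x + y \<bullet> y"
      using xy scalar_prod_self_pos[OF x] scalar_prod_self_pos[OF y]
        scalar_prod_self_nonneg[of x] scalar_prod_self_nonneg[of y] by linarith
    ultimately have b: "b = 0" by simp
    have "A *\<^sub>v x = a \<cdot>\<^sub>v x" "A *\<^sub>v y = a \<cdot>\<^sub>v y" using Ax Ay x y b by auto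
    with xy x y show ?thesis by blast
  qed
  then obtain w where w: "w \<in> carrier_vec n" "w \<noteq> 0\<^sub>v n" "A *\<^sub>v w = a \<cdot>\<^sub>v w" by blast
  define v where "v = (1 / sqrt (w \<bullet> w)) \<cdot>\<^sub>v w"
  have ww: "0 < w \<bullet> w" by (rule scalar_prod_self_pos[OF w(1,2)])
  show thesis
  proof
    show "v \<in> carrier_vec n" using w by (simp add: v_def)
    show "v \<bullet> v = 1" using ww w(1) by (simp add: v_def field_simps)
    show "A *\<^sub>v v = a \<cdot>\<^sub>v v"
      using A w by (simp add: v_def mult_mat_vec smult_smult_assoc mult.commute)
  qed
qed

text \<open>\<open>H\<close> is the reflection in the hyperplane orthogonal to
  \<open>w = v - e0\<close>, where \<open>e0\<close> is the first unit vector. It exchanges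
  \<open>e0\<close> and \<open>v\<close> because both have length 1. For \<open>v = e0\<close>,
  where \<open>w\<close> vanishes, the identity serves.\<close>

lemma householder:
  fixes v :: "real vec"
  assumes v: "v \<in> carrier_vec n" and vv: "v \<bullet> v = 1" and n: "0 < n"
  obtains H where "H \<in> carrier_mat n n" "transpose_mat H = H" "H * H = 1\<^sub>m n"
    "H *\<^sub>v unit_vec n 0 = v"
proof (cases "v = unit_vec n 0")
  case True
  with that[of "1\<^sub>m n"] show thesis by simp
next
  case False
  define w q p H where "w = v - unit_vec n 0" and "q = w \<bullet> w" and "p = 2 / q"
    and "H = mat n n (\<lambda>(i, j). (if i = j then 1 else 0) - p * w $ i * w $ j)"
  have w: "w \<in> carrier_vec n" using v by (simp add: w_def)
  have "w \<noteq> 0\<^sub>v n"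
  proof
    assume 0: "w = 0\<^sub>v n"
    have "v $ i = unit_vec n 0 $ i" if "i < n" for i
      using arg_cong[OF 0, of "\<lambda>u. u $ i"] that v by (simp add: w_def)
    then show False using False v by (auto intro: eq_vecI)
  qed
  then have q: "0 < q" using scalar_prod_self_pos[OF w] by (simp add: q_def)
  have qv: "q = 2 - 2 * v $ 0"
    using v vv n by (simp add: q_def w_def minus_scalar_prod_distrib[of _ n]
        scalar_prod_minus_distrib[of _ n])
  have qs: "(\<Sum>k<n. w $ k * w $ k) = q"
    using w by (simp add: q_def scalar_prod_def atLeast0LessThan)
  show thesis
  proof
    show H: "H \<in> carrier_mat n n" by (simp add: H_def)
    show "transpose_mat H = H" by (auto simp: H_def)
    show "H * H = 1\<^sub>m n"
    proof (rule eq_matI)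
      fix i j assume "i < dim_row (1\<^sub>m n :: real mat)" "j < dim_col (1\<^sub>m n :: real mat)"
      then have ij: "i < n" "j < n" by auto
      have "(H * H) $$ (i, j) = (\<Sum>k<n. H $$ (i, k) * H $$ (k, j))"
        using ij H by (simp add: scalar_prod_def atLeast0LessThan)
      also have "\<dots> = (\<Sum>k<n. (if i = k then (if k = j then 1 else 0) else 0)
          - (if i = k then p * w $ i * w $ j else 0)
          - (if k = j then p * w $ i * w $ j else 0)
          + p\<^sup>2 * w $ i * w $ j * (w $ k * w $ k))"
        using ij by (intro sum.cong) (auto simp: H_def algebra_simps power2_eq_square)
      also have "\<dots> = (if i = j then 1 else 0) - 2 * (p * w $ i * w $ j)
          + (p\<^sup>2 * q) * (w $ i * w $ j)"
        unfolding sum.distrib sum_subtractf sum_distrib_left[symmetric] qs using ij by simp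
      \<comment> \<open>By the choice of \<open>p\<close> the quadratic term of
        \<open>(1 - p w w^T)^2\<close> cancels the two cross terms.\<close>
      also have "p\<^sup>2 * q = 2 * p" using q by (simp add: p_def power2_eq_square)
      also have "(if i = j then 1 else 0) - 2 * (p * w $ i * w $ j) + 2 * p * (w $ i * w $ j)
          = (if i = j then 1 else 0)" by simp
      finally show "(H * H) $$ (i, j) = 1\<^sub>m n $$ (i, j)" using ij by simp
    qed (auto simp: H_def)
    show "H *\<^sub>v unit_vec n 0 = v"
    proof (rule eq_vecI)
      fix i assume "i < dim_vec v"
      then have i: "i < n" using v by simp
      \<comment> \<open>The first coordinate of \<open>w\<close> is \<open>v $ 0 - 1\<close>, which
        is \<open>- q / 2\<close> by \<open>qv\<close>.\<close>
      have w0: "w $ 0 = - q / 2" and wi: "w $ i = v $ i - unit_vec n 0 $ i"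
        using v n i qv by (simp_all add: w_def)
      have "(H *\<^sub>v unit_vec n 0) $ i = H $$ (i, 0)"
        using H i n by (simp add: scalar_prod_right_unit)
      also have "\<dots> = v $ i"
        using i n q by (simp add: H_def w0 wi p_def field_simps)
      finally show "(H *\<^sub>v unit_vec n 0) $ i = v $ i" .
    qed (use v H in auto)
  qed
qed

section \<open>The spectral theorem and sorted eigenvalues\<close>

text \<open>\<open>u\<close> and \<open>d\<close> are total functions of which only the values below
  \<open>n\<close> count. Being orthonormal, \<open>n\<close> vectors in dimension \<open>n\<close>
  span the space.\<close>

definition eigenbasis :: "real mat \<Rightarrow> nat \<Rightarrow> (nat \<Rightarrow> real vec) \<Rightarrow> (nat \<Rightarrow> real) \<Rightarrow> bool" where
  "eigenbasis A n u d \<longleftrightarrow>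
     (\<forall>i<n. u i \<in> carrier_vec n \<and> A *\<^sub>v u i = d i \<cdot>\<^sub>v u i) \<and>
     (\<forall>i<n. \<forall>j<n. u i \<bullet> u j = (if i = j then 1 else 0))"

lemma eigenbasisD:
  assumes "eigenbasis A n u d" "i < n"
  shows "u i \<in> carrier_vec n" "A *\<^sub>v u i = d i \<cdot>\<^sub>v u i"
    "j < n \<Longrightarrow> u i \<bullet> u j = (if i = j then 1 else 0)"
  using assms by (auto simp: eigenbasis_def)

text \<open>Induction on the dimension. A reflection \<open>H\<close> moves a unit eigenvector to
  the first coordinate axis, so in \<open>B = H A H\<close> the first row and column vanish off the
  diagonal, and the induction hypothesis applies to the remaining symmetric block
  \<open>C\<close>.\<close>

theorem spectral_theorem:
  fixes A :: "real mat"
  assumes "A \<in> carrier_mat n n" "transpose_mat A = A"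
  shows "\<exists>u d. eigenbasis A n u d"
  using assms
proof (induction n arbitrary: A)
  case 0
  then show ?case by (auto simp: eigenbasis_def)
next
  case (Suc n)
  note A = Suc.prems(1) and sym = Suc.prems(2)
  obtain v e where v: "v \<in> carrier_vec (Suc n)" "v \<bullet> v = 1" "A *\<^sub>v v = e \<cdot>\<^sub>v v"
    using symmetric_real_eigenvector[OF A sym] by blast
  obtain H where H: "H \<in> carrier_mat (Suc n) (Suc n)" "transpose_mat H = H" "H * H = 1\<^sub>m (Suc n)"
      and He: "H *\<^sub>v unit_vec (Suc n) 0 = v"
    using householder[OF v(1,2)] by blast
  have HH: "H *\<^sub>v (H *\<^sub>v x) = x" if "x \<in> carrier_vec (Suc n)" for x
    using assoc_mult_mat_vec[OF H(1) H(1) that] H(3) that by simp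
  define B where "B = H * (A * H)"
  have B: "B \<in> carrier_mat (Suc n) (Suc n)" using A H by (simp add: B_def)
  have symB: "transpose_mat B = B"
    using A H sym by (simp add: B_def transpose_mult[of _ "Suc n" "Suc n" _ "Suc n"])
  have Bx: "B *\<^sub>v x = H *\<^sub>v (A *\<^sub>v (H *\<^sub>v x))" if "x \<in> carrier_vec (Suc n)" for x
    using A H(1) that by (simp add: B_def assoc_mult_mat_vec[of _ "Suc n" "Suc n" _ "Suc n"])
  have Be: "B *\<^sub>v unit_vec (Suc n) 0 = e \<cdot>\<^sub>v unit_vec (Suc n) 0"
    using H(1) v(1) by (simp add: Bx He v(3) mult_mat_vec HH[of "unit_vec (Suc n) 0", unfolded He])
  have Bi0: "B $$ (Suc i, 0) = 0" if "i < n" for i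
    using arg_cong[OF Be, of "\<lambda>x. x $ Suc i"] B that by simp
  have B0i: "B $$ (0, Suc i) = 0" if "i < n" for i
    using Bi0[OF that] arg_cong[OF symB, of "\<lambda>M. M $$ (0, Suc i)"] B that by simp
  define C where "C = mat n n (\<lambda>(i, j). B $$ (Suc i, Suc j))"
  have C: "C \<in> carrier_mat n n" by (simp add: C_def)
  have symC: "transpose_mat C = C"
  proof (rule eq_matI)
    fix i j assume "i < dim_row C" "j < dim_col C"
    then have ij: "i < n" "j < n" by (auto simp: C_def)
    then show "transpose_mat C $$ (i, j) = C $$ (i, j)"
      using arg_cong[OF symB, of "\<lambda>M. M $$ (Suc i, Suc j)"] B by (simp add: C_def)
  qed (auto simp: C_def)
  have BC: "B *\<^sub>v vCons 0 y = vCons 0 (C *\<^sub>v y)" if y: "y \<in> carrier_vec n" for y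
  proof (rule eq_vecI)
    fix i assume "i < dim_vec (vCons 0 (C *\<^sub>v y))"
    then have i: "i < Suc n" using C by simp
    have "(B *\<^sub>v vCons 0 y) $ i = (\<Sum>j<Suc n. B $$ (i, j) * vCons 0 y $ j)"
      using B y i by (simp add: scalar_prod_def atLeast0LessThan del: sum.lessThan_Suc)
    also have "\<dots> = (\<Sum>j<n. B $$ (i, Suc j) * y $ j)"
      using y by (subst sum.lessThan_Suc_shift) simp
    also have "\<dots> = vCons 0 (C *\<^sub>v y) $ i"
      using i y B0i C by (cases i) (auto simp: scalar_prod_def atLeast0LessThan C_def intro!: sum.cong)
    finally show "(B *\<^sub>v vCons 0 y) $ i = vCons 0 (C *\<^sub>v y) $ i" .
  qed (use B C in auto)
  obtain u d where ud: "eigenbasis C n u d" using Suc.IH[OF C symC] by blast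
  \<comment> \<open>An eigenbasis of \<open>B\<close>: the first unit vector, followed by the
    eigenvectors of \<open>C\<close> with a zero prepended.\<close>
  define w where "w = case_nat (unit_vec (Suc n) 0) (\<lambda>k. vCons 0 (u k))"
  define f where "f = case_nat e d"
  have w: "w i \<in> carrier_vec (Suc n)" if "i < Suc n" for i
    using that eigenbasisD(1)[OF ud] by (auto simp: w_def split: nat.split)
  have Bw: "B *\<^sub>v w i = f i \<cdot>\<^sub>v w i" if i: "i < Suc n" for i
  proof (cases i)
    case 0
    then show ?thesis by (simp add: w_def f_def Be)
  next
    case (Suc k)
    then have k: "k < n" using i by simp
    have "B *\<^sub>v w i = vCons 0 (d k \<cdot>\<^sub>v u k)"
      using eigenbasisD(1,2)[OF ud k] by (simp add: w_def Suc BC)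
    also have "\<dots> = d k \<cdot>\<^sub>v vCons 0 (u k)"
      by (rule eq_vecI) (auto simp: vec_index_vCons)
    finally show ?thesis by (simp add: w_def f_def Suc)
  qed
  have e0: "unit_vec (Suc n) 0 = vCons (1::real) (0\<^sub>v n)"
    by (rule eq_vecI) (auto simp: vec_index_vCons)
  have ww: "w i \<bullet> w j = (if i = j then 1 else 0)" if ij: "i < Suc n" "j < Suc n" for i j
    using ij eigenbasisD(1)[OF ud] eigenbasisD(3)[OF ud]
    by (cases i; cases j) (auto simp: w_def e0)
  have "eigenbasis A (Suc n) (\<lambda>i. H *\<^sub>v w i) f"
    unfolding eigenbasis_def
  proof (intro conjI allI impI)
    fix i assume i: "i < Suc n"
    show "H *\<^sub>v w i \<in> carrier_vec (Suc n)" using H w[OF i] by simp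
    \<comment> \<open>As \<open>H\<close> is an involution, \<open>A H = H B\<close>; hence
      \<open>H\<close> carries eigenvectors of \<open>B\<close> to eigenvectors of
      \<open>A\<close>.\<close>
    have "A *\<^sub>v (H *\<^sub>v w i) = H *\<^sub>v (B *\<^sub>v w i)"
      using A H(1) w[OF i] by (simp add: Bx HH)
    then show "A *\<^sub>v (H *\<^sub>v w i) = f i \<cdot>\<^sub>v (H *\<^sub>v w i)"
      using H(1) w[OF i] by (simp add: Bw[OF i] mult_mat_vec)
    fix j assume j: "j < Suc n"
    have "(H *\<^sub>v w i) \<bullet> (H *\<^sub>v w j) = w i \<bullet> w j"
      using H w[OF i] w[OF j] by (simp add: mult_mat_vec_scalar_prod[OF H(1)] HH)
    then show "(H *\<^sub>v w i) \<bullet> (H *\<^sub>v w j) = (if i = j then 1 else 0)"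
      using ww[OF i j] by simp
  qed
  then show ?case by blast
qed

section \<open>Orthonormal eigenbases as orthogonal matrices\<close>

definition basis_mat :: "nat \<Rightarrow> (nat \<Rightarrow> real vec) \<Rightarrow> real mat" where
  "basis_mat n u = mat n n (\<lambda>(i, j). u j $ i)"

lemma basis_mat_carrier [simp]:
  "basis_mat n u \<in> carrier_mat n n" "dim_row (basis_mat n u) = n" "dim_col (basis_mat n u) = n"
  by (simp_all add: basis_mat_def)

lemma scalar_prod_vec: "vec n f \<bullet> vec n g = (\<Sum>i<n. f i * g i)"
  by (simp add: scalar_prod_def atLeast0LessThan)

lemma col_basis_mat: "j < n \<Longrightarrow> u j \<in> carrier_vec n \<Longrightarrow> col (basis_mat n u) j = u j"
  by (auto simp: basis_mat_def)

lemma transpose_basis_mat_mult_vec: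
  assumes "\<And>i. i < n \<Longrightarrow> u i \<in> carrier_vec n"
  shows "transpose_mat (basis_mat n u) *\<^sub>v x = vec n (\<lambda>i. u i \<bullet> x)"
  using assms by (intro eq_vecI) (auto simp: col_basis_mat)

lemma basis_mat_orthogonal:
  assumes "eigenbasis A n u d"
  shows "transpose_mat (basis_mat n u) * basis_mat n u = 1\<^sub>m n"
    "basis_mat n u * transpose_mat (basis_mat n u) = 1\<^sub>m n"
proof -
  show *: "transpose_mat (basis_mat n u) * basis_mat n u = 1\<^sub>m n"
    using eigenbasisD(1,3)[OF assms]
    by (intro eq_matI) (auto simp: col_basis_mat)
  show "basis_mat n u * transpose_mat (basis_mat n u) = 1\<^sub>m n"
    by (rule mat_mult_left_right_inverse[OF _ _ *]) auto
qed

lemma basis_mat_diagonalizes: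
  assumes "A \<in> carrier_mat n n" "eigenbasis A n u d"
  shows "A * basis_mat n u = basis_mat n u * mat_diag n d"
proof (rule eq_matI)
  fix i j assume "i < dim_row (basis_mat n u * mat_diag n d)"
    and "j < dim_col (basis_mat n u * mat_diag n d)"
  then have ij: "i < n" "j < n" by (auto simp: basis_mat_def mat_diag_def)
  have u: "u j \<in> carrier_vec n" by (rule eigenbasisD(1)[OF assms(2) ij(2)])
  have "(A * basis_mat n u) $$ (i, j) = (A *\<^sub>v u j) $ i"
    using ij assms(1) u by (simp add: col_basis_mat)
  also have "\<dots> = d j * u j $ i"
    using ij u by (simp add: eigenbasisD(2)[OF assms(2) ij(2)])
  also have "\<dots> = (basis_mat n u * mat_diag n d) $$ (i, j)"
    using ij by (subst mat_diag_mult_right[of _ n]) (auto simp: basis_mat_def)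
  finally show "(A * basis_mat n u) $$ (i, j) = (basis_mat n u * mat_diag n d) $$ (i, j)" .
qed (use assms in \<open>auto simp: basis_mat_def mat_diag_def\<close>)

text \<open>\<open>A\<close> is similar to the diagonal matrix of \<open>d\<close>, so the
  characteristic polynomials agree. Hence any eigenbasis reveals the spectrum with
  multiplicities.\<close>

lemma eigenvalues_eigenbasis:
  assumes A: "A \<in> carrier_mat n n" and ud: "eigenbasis A n u d"
  shows "eigenvalues A = mset (map d [0..<n])"
proof -
  let ?U = "basis_mat n u" and ?D = "mat_diag n d"
  note U = basis_mat_orthogonal[OF ud]
  have D: "?D \<in> carrier_mat n n" by simp
  have "A = A * (?U * transpose_mat ?U)" using A U(2) by simp
  also have "\<dots> = A * ?U * transpose_mat ?U" using A by (subst assoc_mult_mat[of _ n n _ n _ n]) auto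
  also have "\<dots> = ?U * ?D * transpose_mat ?U" by (simp only: basis_mat_diagonalizes[OF A ud])
  finally have "similar_mat_wit A ?D ?U (transpose_mat ?U)"
    using U A by (intro similar_mat_witI[of _ _ n]) auto
  then have "similar_mat A ?D" by (auto simp: similar_mat_def)
  then have "char_poly A = char_poly ?D" by (rule char_poly_similar)
  also have "\<dots> = (\<Prod>a\<leftarrow>diag_mat ?D. [:- a, 1:])"
    by (rule char_poly_upper_triangular[OF D]) (auto simp: mat_diag_def upper_triangular_def)
  also have "diag_mat ?D = map d [0..<n]"
    by (auto simp: diag_mat_def mat_diag_def)
  finally have cp: "char_poly A = (\<Prod>a\<leftarrow>map d [0..<n]. [:- a, 1:])" .
  have "proots (\<Prod>a\<leftarrow>xs. [:- a, 1:]) = mset xs" for xs :: "real list"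
  proof (induction xs)
    case (Cons a xs)
    have "(\<Prod>a\<leftarrow>xs. [:- a, 1:]) \<noteq> 0" by (auto simp: prod_list_zero_iff)
    then have "proots ([:- a, 1:] * (\<Prod>a\<leftarrow>xs. [:- a, 1:])) = add_mset a (mset xs)"
      by (subst proots_mult) (auto simp: Cons.IH)
    then show ?case by simp
  qed simp
  then show ?thesis by (simp only: eigenvalues_def cp)
qed

text \<open>Parseval's identity and the diagonal form of the quadratic form, both read off from the
  coordinates \<open>c\<close> of \<open>x\<close> in the eigenbasis.\<close>

lemma eigenbasis_expansion:
  assumes A: "A \<in> carrier_mat n n" and ud: "eigenbasis A n u d" and x: "x \<in> carrier_vec n"
  shows "x \<bullet> x = (\<Sum>i<n. (u i \<bullet> x)\<^sup>2)" "x \<bullet> (A *\<^sub>v x) = (\<Sum>i<n. d i * (u i \<bullet> x)\<^sup>2)"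
proof -
  let ?U = "basis_mat n u" and ?D = "mat_diag n d"
  define c where "c = transpose_mat ?U *\<^sub>v x"
  have c: "c = vec n (\<lambda>i. u i \<bullet> x)"
    unfolding c_def by (rule transpose_basis_mat_mult_vec) (rule eigenbasisD(1)[OF ud])
  have cc: "c \<in> carrier_vec n" by (simp add: c)
  note U = basis_mat_orthogonal[OF ud]
  have Uc: "?U *\<^sub>v c = x"
    using x U(2) assoc_mult_mat_vec[of ?U n n "transpose_mat ?U" n x] by (simp add: c_def)
  have Uy: "x \<bullet> (?U *\<^sub>v y) = c \<bullet> y" if "y \<in> carrier_vec n" for y
    using transpose_vec_mult_scalar[of ?U n n y x] x that by (simp add: c_def)
  have "x \<bullet> x = c \<bullet> c" using Uy[OF cc] Uc by simp
  then show "x \<bullet> x = (\<Sum>i<n. (u i \<bullet> x)\<^sup>2)"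
    by (simp add: c scalar_prod_vec power2_eq_square)
  have "A *\<^sub>v x = (A * ?U) *\<^sub>v c" using A cc Uc by (subst assoc_mult_mat_vec[of _ n n _ n]) auto
  also have "\<dots> = ?U *\<^sub>v (?D *\<^sub>v c)"
    unfolding basis_mat_diagonalizes[OF A ud] using cc by (subst assoc_mult_mat_vec[of _ n n _ n]) auto
  finally have Ax: "A *\<^sub>v x = ?U *\<^sub>v (?D *\<^sub>v c)" .
  have Dc: "?D *\<^sub>v c = vec n (\<lambda>i. d i * (u i \<bullet> x))"
    by (rule eq_vecI) (auto simp: mat_diag_def c scalar_prod_def if_distrib if_distribR cong: if_cong)
  have "x \<bullet> (A *\<^sub>v x) = c \<bullet> (?D *\<^sub>v c)" unfolding Ax by (rule Uy) (simp add: Dc)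
  then show "x \<bullet> (A *\<^sub>v x) = (\<Sum>i<n. d i * (u i \<bullet> x)\<^sup>2)"
    unfolding Dc unfolding c scalar_prod_vec by (simp add: power2_eq_square ac_simps)
qed

text \<open>Positions in this list start at 0, whereas \<open>singular_value\<close> counts from
  1.\<close>

definition desc_eigenvalues :: "real mat \<Rightarrow> real list" where
  "desc_eigenvalues A = rev (sorted_list_of_multiset (eigenvalues A))"

lemma mset_desc_eigenvalues [simp]: "mset (desc_eigenvalues A) = eigenvalues A"
  by (simp add: desc_eigenvalues_def)

lemma desc_eigenvalues_antimono:
  "i \<le> j \<Longrightarrow> j < length (desc_eigenvalues A) \<Longrightarrow> desc_eigenvalues A ! j \<le> desc_eigenvalues A ! i"
  unfolding desc_eigenvalues_def
  by (rule sorted_rev_nth_mono) (auto simp: sorted_sorted_list_of_multiset)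

text \<open>The spectral theorem gives the eigenvalues in some order. They form the same multiset as
  the sorted list, so a permutation of the indices sorts the eigenbasis.\<close>

lemma symmetric_desc_eigenbasis:
  fixes A :: "real mat"
  assumes A: "A \<in> carrier_mat n n" and sym: "transpose_mat A = A"
  shows "\<exists>u. eigenbasis A n u ((!) (desc_eigenvalues A))" "length (desc_eigenvalues A) = n"
proof -
  obtain u d where ud: "eigenbasis A n u d" using spectral_theorem[OF A sym] by blast
  have m: "mset (desc_eigenvalues A) = mset (map d [0..<n])"
    by (simp only: mset_desc_eigenvalues eigenvalues_eigenbasis[OF A ud])
  then show len: "length (desc_eigenvalues A) = n"
    using mset_eq_length[OF m] by simp
  obtain f where f: "bij_betw f {..<n} {..<n}"
      "\<And>i. i < n \<Longrightarrow> desc_eigenvalues A ! i = map d [0..<n] ! f i"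
    using permutation_Ex_bij[OF m] len by auto
  have fl: "f i < n" if "i < n" for i using bij_betwE[OF f(1)] that by auto
  have fi: "f i = f j \<longleftrightarrow> i = j" if "i < n" "j < n" for i j
    using bij_betw_imp_inj_on[OF f(1)] that by (auto dest: inj_onD)
  have "eigenbasis A n (\<lambda>i. u (f i)) ((!) (desc_eigenvalues A))"
    using ud fl fi by (auto simp: eigenbasis_def f(2))
  then show "\<exists>u. eigenbasis A n u ((!) (desc_eigenvalues A))" by blast
qed

section \<open>Interlacing and singular values\<close>

text \<open>The minimax argument: the images under \<open>T\<close> of the span of the top \<open>i + 1\<close> eigenvectors of
  \<open>M\<close> contain a vector orthogonal to the top \<open>i\<close> eigenvectors of \<open>A\<close>, because \<open>i\<close> homogeneous
  equations in \<open>i + 1\<close> unknowns have a non-zero solution.\<close>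

lemma eigenvalue_interlacing:
  fixes A M T :: "real mat"
  assumes A: "A \<in> carrier_mat n n" "transpose_mat A = A"
    and M: "M \<in> carrier_mat m m" "transpose_mat M = M"
    and T: "T \<in> carrier_mat n m" and i: "i < m"
  obtains y where "y \<in> carrier_vec m" "0 < y \<bullet> y"
    "desc_eigenvalues M ! i * (y \<bullet> y) \<le> y \<bullet> (M *\<^sub>v y)"
    "i < n \<Longrightarrow> (T *\<^sub>v y) \<bullet> (A *\<^sub>v (T *\<^sub>v y)) \<le> desc_eigenvalues A ! i * ((T *\<^sub>v y) \<bullet> (T *\<^sub>v y))"
    "n \<le> i \<Longrightarrow> T *\<^sub>v y = 0\<^sub>v n"
proof -
  obtain u where u: "eigenbasis A n u ((!) (desc_eigenvalues A))"
    using symmetric_desc_eigenbasis(1)[OF A] by blast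
  obtain w where w: "eigenbasis M m w ((!) (desc_eigenvalues M))"
    using symmetric_desc_eigenbasis(1)[OF M] by blast
  note lenA = symmetric_desc_eigenbasis(2)[OF A] and lenM = symmetric_desc_eigenbasis(2)[OF M]
  \<comment> \<open>The homogeneous system of the minimax argument. Its \<open>min i n\<close>
    equations are padded with zero rows to a square matrix; row \<open>i\<close> is always zero, so
    the determinant vanishes.\<close>
  define K where "K = mat (Suc i) (Suc i)
    (\<lambda>(l, k). if l < min i n then u l \<bullet> (T *\<^sub>v w k) else 0)"
  have K: "K \<in> carrier_mat (Suc i) (Suc i)" by (simp add: K_def)
  have "det K = 0"
    by (subst laplace_expansion_row[OF K, of i]) (auto simp: K_def)
  then obtain a where a: "a \<in> carrier_vec (Suc i)" "a \<noteq> 0\<^sub>v (Suc i)" "K *\<^sub>v a = 0\<^sub>v (Suc i)"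
    using det_0_iff_vec_prod_zero[OF K] by blast
  define b where "b = vec m (\<lambda>k. if k \<le> i then a $ k else 0)"
  define y where "y = basis_mat m w *\<^sub>v b"
  have b: "b \<in> carrier_vec m" by (simp add: b_def)
  have y: "y \<in> carrier_vec m"
    unfolding y_def using b by (intro mult_mat_vec_carrier[of _ m m]) auto
  have "transpose_mat (basis_mat m w) *\<^sub>v y = b"
    using basis_mat_orthogonal(1)[OF w] b
      assoc_mult_mat_vec[of "transpose_mat (basis_mat m w)" m m "basis_mat m w" m b]
    by (simp add: y_def)
  then have yb: "vec m (\<lambda>k. w k \<bullet> y) = b"
    using transpose_basis_mat_mult_vec[of m w y] eigenbasisD(1)[OF w] by simp
  have wy: "w k \<bullet> y = (if k \<le> i then a $ k else 0)" if "k < m" for k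
    using arg_cong[OF yb, of "\<lambda>x. x $ k"] that by (simp add: b_def)
  obtain k where k: "k < Suc i" "a $ k \<noteq> 0"
    using a(1,2) by (metis carrier_vecD dim_vec eq_vecI index_zero_vec(1,2))
  have "y \<noteq> 0\<^sub>v m"
    using wy[of k] k i eigenbasisD(1)[OF w, of k] by auto
  then have ypos: "0 < y \<bullet> y" by (rule scalar_prod_self_pos[OF y])
  \<comment> \<open>\<open>y\<close> has components only along the top \<open>i + 1\<close>
    eigenvectors of \<open>M\<close>, whose eigenvalues are at least the one at position
    \<open>i\<close>.\<close>
  have M_ge: "desc_eigenvalues M ! i * (y \<bullet> y) \<le> y \<bullet> (M *\<^sub>v y)"
    unfolding eigenbasis_expansion[OF M(1) w y] sum_distrib_left
  proof (rule sum_mono)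
    fix k assume "k \<in> {..<m}"
    then show "desc_eigenvalues M ! i * (w k \<bullet> y)\<^sup>2 \<le> desc_eigenvalues M ! k * (w k \<bullet> y)\<^sup>2"
      using desc_eigenvalues_antimono[of k i M] lenM i
      by (cases "k \<le> i") (auto simp: wy intro: mult_right_mono)
  qed
  have Ty: "T *\<^sub>v y \<in> carrier_vec n" using T y by simp
  have orth: "u l \<bullet> (T *\<^sub>v y) = 0" if l: "l < min i n" for l
  proof -
    have ul: "u l \<in> carrier_vec n" using eigenbasisD(1)[OF u] l by simp
    define t where "t = transpose_mat T *\<^sub>v u l"
    have t: "t \<in> carrier_vec m" using T ul by (simp add: t_def)
    have tx: "u l \<bullet> (T *\<^sub>v x) = t \<bullet> x" if "x \<in> carrier_vec m" for x
      using transpose_vec_mult_scalar[OF T that ul] by (simp add: t_def)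
    have "u l \<bullet> (T *\<^sub>v y) = t \<bullet> (basis_mat m w *\<^sub>v b)" using tx[OF y] by (simp add: y_def)
    also have "\<dots> = (transpose_mat (basis_mat m w) *\<^sub>v t) \<bullet> b"
      using transpose_vec_mult_scalar[of "basis_mat m w" m m b t] b t by simp
    also have "\<dots> = (\<Sum>k<m. (w k \<bullet> t) * (if k \<le> i then a $ k else 0))"
      by (subst transpose_basis_mat_mult_vec) (auto simp: eigenbasisD(1)[OF w] b_def scalar_prod_vec)
    also have "\<dots> = (\<Sum>k<Suc i. (w k \<bullet> t) * a $ k)"
      using i by (intro sum.mono_neutral_cong_right) auto
    also have "\<dots> = (\<Sum>k<Suc i. K $$ (l, k) * a $ k)"
    proof (rule sum.cong)
      fix k assume "k \<in> {..<Suc i}"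
      then have k: "k < m" "k < Suc i" using i by auto
      have wk: "w k \<in> carrier_vec m" by (rule eigenbasisD(1)[OF w k(1)])
      show "(w k \<bullet> t) * a $ k = K $$ (l, k) * a $ k"
        using l k tx[OF wk] comm_scalar_prod[OF wk t] by (simp add: K_def)
    qed simp
    also have "\<dots> = (K *\<^sub>v a) $ l"
      using l K a(1) by (simp add: scalar_prod_def atLeast0LessThan del: sum.lessThan_Suc)
    also have "\<dots> = 0" using a(3) l by simp
    finally show ?thesis .
  qed
  \<comment> \<open>By \<open>orth\<close> only eigenvalues of \<open>A\<close> from position
    \<open>i\<close> on contribute.\<close>
  have A_le: "(T *\<^sub>v y) \<bullet> (A *\<^sub>v (T *\<^sub>v y)) \<le> desc_eigenvalues A ! i * ((T *\<^sub>v y) \<bullet> (T *\<^sub>v y))"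
    if "i < n"
    unfolding eigenbasis_expansion[OF A(1) u Ty] sum_distrib_left
  proof (rule sum_mono)
    fix l assume "l \<in> {..<n}"
    then show "desc_eigenvalues A ! l * (u l \<bullet> (T *\<^sub>v y))\<^sup>2 \<le> desc_eigenvalues A ! i * (u l \<bullet> (T *\<^sub>v y))\<^sup>2"
      using desc_eigenvalues_antimono[of i l A] lenA orth[of l]
      by (cases "l < i") (auto intro: mult_right_mono)
  qed
  \<comment> \<open>Here \<open>orth\<close> covers the whole eigenbasis of
    \<open>A\<close>.\<close>
  have "T *\<^sub>v y = 0\<^sub>v n" if "n \<le> i"
  proof -
    have "(T *\<^sub>v y) \<bullet> (T *\<^sub>v y) = 0"
      unfolding eigenbasis_expansion(1)[OF A(1) u Ty] using orth that by (intro sum.neutral) auto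
    then show ?thesis using scalar_prod_self_eq_0[OF Ty] by simp
  qed
  with y ypos M_ge A_le show thesis by (rule that)
qed

section \<open>Gram matrices and squared singular values\<close>

lemma symmetric_gram: "transpose_mat (transpose_mat W * W) = transpose_mat W * (W :: real mat)"
  by (subst transpose_mult[of _ "dim_col W" "dim_row W" _ "dim_col W"]) auto

lemma symmetric_gram': "transpose_mat (W * transpose_mat W) = W * transpose_mat (W :: real mat)"
  using symmetric_gram[of "transpose_mat W"] by simp

lemma gram_scalar_prod:
  fixes W :: "real mat"
  assumes "W \<in> carrier_mat p q" "x \<in> carrier_vec q"
  shows "x \<bullet> ((transpose_mat W * W) *\<^sub>v x) = (W *\<^sub>v x) \<bullet> (W *\<^sub>v x)"
  unfolding mult_mat_vec_scalar_prod[OF assms assms(2)]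
  using assms by (subst assoc_mult_mat_vec[of _ q p _ q]) auto

text \<open>On a unit eigenvector the quadratic form equals the eigenvalue.\<close>

lemma psd_eigenvalue_nonneg:
  fixes A :: "real mat"
  assumes A: "A \<in> carrier_mat n n" "transpose_mat A = A"
    and psd: "\<And>x. x \<in> carrier_vec n \<Longrightarrow> 0 \<le> x \<bullet> (A *\<^sub>v x)" and i: "i < n"
  shows "0 \<le> desc_eigenvalues A ! i"
proof -
  obtain u where u: "eigenbasis A n u ((!) (desc_eigenvalues A))"
    using symmetric_desc_eigenbasis(1)[OF A] by blast
  show ?thesis
    using psd[OF eigenbasisD(1)[OF u i]] eigenbasisD(1)[OF u i] eigenbasisD(3)[OF u i i]
    by (simp add: eigenbasisD(2)[OF u i])
qed

lemma gram_eigenvalue_nonneg: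
  fixes W :: "real mat"
  assumes W: "W \<in> carrier_mat p q" and i: "i < q"
  shows "0 \<le> desc_eigenvalues (transpose_mat W * W) ! i"
proof (rule psd_eigenvalue_nonneg[OF _ symmetric_gram _ i])
  show "transpose_mat W * W \<in> carrier_mat q q" using W by simp
  show "0 \<le> x \<bullet> ((transpose_mat W * W) *\<^sub>v x)" if "x \<in> carrier_vec q" for x
    unfolding gram_scalar_prod[OF W that] by (rule scalar_prod_self_nonneg)
qed

text \<open>The span of the top \<open>i + 1\<close> eigenvectors has dimension greater than
  \<open>p\<close>, so it meets the kernel of \<open>W\<close>. There the quadratic form is 0, which
  bounds the eigenvalue from above.\<close>

lemma gram_eigenvalue_eq_0:
  fixes W :: "real mat"
  assumes W: "W \<in> carrier_mat p q" and i: "p \<le> i" "i < q"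
  shows "desc_eigenvalues (transpose_mat W * W) ! i = 0"
proof -
  have G: "transpose_mat W * W \<in> carrier_mat q q" using W by simp
  obtain y where y: "y \<in> carrier_vec q" "0 < y \<bullet> y"
      "desc_eigenvalues (transpose_mat W * W) ! i * (y \<bullet> y) \<le> y \<bullet> ((transpose_mat W * W) *\<^sub>v y)"
      "W *\<^sub>v y = 0\<^sub>v p"
    using eigenvalue_interlacing[OF _ _ G symmetric_gram W i(2), of "1\<^sub>m p"] i by auto
  then have "desc_eigenvalues (transpose_mat W * W) ! i * (y \<bullet> y) \<le> 0"
    by (simp add: gram_scalar_prod[OF W])
  then have "desc_eigenvalues (transpose_mat W * W) ! i \<le> 0"
    using y(2) by (simp add: mult_le_0_iff)
  then show ?thesis using gram_eigenvalue_nonneg[OF W i(2)] by simp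
qed

text \<open>One half of the fact that \<open>W^T W\<close> and \<open>W W^T\<close> share their
  non-zero eigenvalues; the other half follows by transposing \<open>W\<close>. Interlacing along
  \<open>W\<close> bounds \<open>W^T W y\<close> in terms of \<open>W y\<close>, and Cauchy-Schwarz
  turns this into a bound on \<open>W y\<close> in terms of \<open>y\<close>.\<close>

lemma gram_eigenvalue_le_gram':
  fixes W :: "real mat"
  assumes W: "W \<in> carrier_mat p q" and i: "i < p" "i < q"
  shows "desc_eigenvalues (transpose_mat W * W) ! i \<le> desc_eigenvalues (W * transpose_mat W) ! i"
proof -
  define \<mu> \<alpha> where "\<mu> = desc_eigenvalues (transpose_mat W * W) ! i"
    and "\<alpha> = desc_eigenvalues (W * transpose_mat W) ! i"
  have W': "transpose_mat W \<in> carrier_mat q p" using W by simp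
  have G: "transpose_mat W * W \<in> carrier_mat q q" and G': "W * transpose_mat W \<in> carrier_mat p p"
    using W by auto
  obtain y where y: "y \<in> carrier_vec q" "0 < y \<bullet> y"
      "\<mu> * (y \<bullet> y) \<le> y \<bullet> ((transpose_mat W * W) *\<^sub>v y)"
      "(W *\<^sub>v y) \<bullet> ((W * transpose_mat W) *\<^sub>v (W *\<^sub>v y)) \<le> \<alpha> * ((W *\<^sub>v y) \<bullet> (W *\<^sub>v y))"
    using eigenvalue_interlacing[OF G' symmetric_gram' G symmetric_gram W i(2)] i
    unfolding \<mu>_def \<alpha>_def by metis
  define z where "z = W *\<^sub>v y"
  define t where "t = transpose_mat W *\<^sub>v z"
  have z: "z \<in> carrier_vec p" and t: "t \<in> carrier_vec q" using W y by (auto simp: z_def t_def)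
  have 1: "\<mu> * (y \<bullet> y) \<le> z \<bullet> z" using y(3) by (simp add: gram_scalar_prod[OF W y(1)] z_def)
  have 2: "t \<bullet> t \<le> \<alpha> * (z \<bullet> z)"
    using y(4) gram_scalar_prod[OF W' z] by (simp add: z_def t_def)
  have "z \<bullet> z = y \<bullet> t"
    using mult_mat_vec_scalar_prod[OF W y(1) y(1)] by (simp add: z_def t_def)
  then have "(z \<bullet> z)\<^sup>2 \<le> (y \<bullet> y) * (t \<bullet> t)" using Cauchy_Schwarz_vec[OF y(1) t] by simp
  also have "\<dots> \<le> (y \<bullet> y) * (\<alpha> * (z \<bullet> z))" using 2 y(2) by (intro mult_left_mono) auto
  finally have 3: "(z \<bullet> z) * (z \<bullet> z) \<le> (\<alpha> * (y \<bullet> y)) * (z \<bullet> z)"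
    by (simp add: power2_eq_square ac_simps)
  \<comment> \<open>This settles the case \<open>z \<bullet> z = 0\<close>, in which the common
    factor cannot be cancelled.\<close>
  have "0 \<le> \<alpha>" using gram_eigenvalue_nonneg[OF W' i(1)] by (simp add: \<alpha>_def)
  then have "z \<bullet> z \<le> \<alpha> * (y \<bullet> y)"
    using 3 y(2) scalar_prod_self_nonneg[of z]
    by (cases "z \<bullet> z = 0") (auto simp: mult_le_cancel_right)
  with 1 have "\<mu> * (y \<bullet> y) \<le> \<alpha> * (y \<bullet> y)" by linarith
  then show ?thesis using y(2) by (simp add: \<mu>_def \<alpha>_def)
qed

text \<open>For \<open>i < p\<close>, taking roots commutes with sorting because \<open>sqrt\<close>
  is monotone. For \<open>i \<ge> p\<close>, the default value 0 agrees with the vanishing Gram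
  eigenvalue.\<close>

lemma singular_value_sq:
  assumes W: "W \<in> carrier_mat p q" and i: "i < q"
  shows "(singular_value (Suc i) W)\<^sup>2 = desc_eigenvalues (transpose_mat W * W) ! i"
proof (cases "i < p")
  case True
  let ?G = "transpose_mat W * W" and ?s = "sorted_list_of_multiset (eigenvalues (transpose_mat W * W))"
  have len: "length (desc_eigenvalues ?G) = q"
    using symmetric_desc_eigenbasis(2)[of ?G q] W symmetric_gram[of W] by simp
  have "sorted (map sqrt ?s)" by (rule sorted_map_mono) (auto simp: monotone_on_def)
  then have "sorted_list_of_multiset (mset (map sqrt ?s)) = map sqrt ?s"
    by (simp only: sorted_list_of_multiset_mset sorted_sort_id)
  then have "sorted_list_of_multiset (image_mset sqrt (eigenvalues ?G)) = map sqrt ?s"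
    by (simp only: mset_map mset_sorted_list_of_multiset)
  then have "singular_value (Suc i) W = map sqrt (desc_eigenvalues ?G) ! i"
    using True W i by (simp add: singular_value_def desc_eigenvalues_def rev_map)
  then show ?thesis using gram_eigenvalue_nonneg[OF W i] i len by simp
next
  case False
  then show ?thesis using gram_eigenvalue_eq_0[OF W _ i] W by (simp add: singular_value_def)
qed

text \<open>The version for \<open>W2\<close>, which enters the NTK through \<open>W2 W2^T\<close>.
  Where both Gram matrices have an eigenvalue at position \<open>i\<close>, two opposite
  inequalities identify them.\<close>

lemma singular_value_sq':
  assumes W: "W \<in> carrier_mat p q" and i: "i < p"
  shows "(singular_value (Suc i) W)\<^sup>2 = desc_eigenvalues (W * transpose_mat W) ! i"
proof (cases "i < q")
  case True
  have W': "transpose_mat W \<in> carrier_mat q p" using W by simp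
  show ?thesis
    unfolding singular_value_sq[OF W True]
    using gram_eigenvalue_le_gram'[OF W i True] gram_eigenvalue_le_gram'[OF W' True i]
    by (intro antisym) simp_all
next
  case False
  then show ?thesis using gram_eigenvalue_eq_0[of "transpose_mat W" q p i] W i
    by (simp add: singular_value_def)
qed

section \<open>Spectral norm and Kronecker vectors\<close>

text \<open>\<open>A x - c x\<close> is orthogonal to every basis vector, hence zero by Parseval's
  identity.\<close>

lemma eigenbasis_single_eigenvalue:
  fixes A :: "real mat"
  assumes A: "A \<in> carrier_mat n n" "transpose_mat A = A"
    and ud: "eigenbasis A n u d" and c: "\<And>i. i < n \<Longrightarrow> d i = c" and x: "x \<in> carrier_vec n"
  shows "A *\<^sub>v x = c \<cdot>\<^sub>v x"
proof -
  define z where "z = A *\<^sub>v x - c \<cdot>\<^sub>v x"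
  have Ax: "A *\<^sub>v x \<in> carrier_vec n" using A(1) x by simp
  have z: "z \<in> carrier_vec n" using Ax x by (simp add: z_def)
  have "u i \<bullet> z = 0" if i: "i < n" for i
  proof -
    have u: "u i \<in> carrier_vec n" "A *\<^sub>v u i = c \<cdot>\<^sub>v u i"
      using eigenbasisD(1,2)[OF ud i] c[OF i] by auto
    have "u i \<bullet> (A *\<^sub>v x) = c * (u i \<bullet> x)"
      using symmetric_scalar_prod[OF A u(1) x] u x by simp
    then show ?thesis using u(1) x Ax by (simp add: z_def scalar_prod_minus_distrib[of _ n])
  qed
  then have "z \<bullet> z = 0" unfolding eigenbasis_expansion(1)[OF A(1) ud z] by simp
  then have z0: "z = 0\<^sub>v n" using scalar_prod_self_eq_0[OF z] by simp
  show ?thesis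
  proof (rule eq_vecI)
    fix i assume "i < dim_vec (c \<cdot>\<^sub>v x)"
    then show "(A *\<^sub>v x) $ i = (c \<cdot>\<^sub>v x) $ i"
      using arg_cong[OF z0, of "\<lambda>z. z $ i"] x by (simp add: z_def del: index_mult_mat_vec)
  qed (use A x in auto)
qed

section \<open>The spectral norm as a bound on stretching\<close>

lemma euclidean_norm_sq: "(euclidean_norm v)\<^sup>2 = v \<bullet> v"
  by (simp add: euclidean_norm_def scalar_prod_self_nonneg)

lemma euclidean_norm_nonneg: "0 \<le> euclidean_norm v"
  by (simp add: euclidean_norm_def scalar_prod_self_nonneg)

text \<open>In an eigenbasis of the Gram matrix every eigenvalue is at most the first. The estimate
  serves to show that the set whose supremum is \<open>spectral_norm X\<close> is bounded
  above.\<close>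

lemma scalar_prod_mult_mat_le_largest:
  fixes X :: "real mat"
  assumes X: "X \<in> carrier_mat p q" and q: "0 < q" and v: "v \<in> carrier_vec q"
  shows "(X *\<^sub>v v) \<bullet> (X *\<^sub>v v) \<le> desc_eigenvalues (transpose_mat X * X) ! 0 * (v \<bullet> v)"
proof -
  let ?G = "transpose_mat X * X"
  have G: "?G \<in> carrier_mat q q" using X by simp
  obtain u where u: "eigenbasis ?G q u ((!) (desc_eigenvalues ?G))"
    using symmetric_desc_eigenbasis(1)[OF G symmetric_gram] by blast
  have "(\<Sum>i<q. desc_eigenvalues ?G ! i * (u i \<bullet> v)\<^sup>2)
      \<le> (\<Sum>i<q. desc_eigenvalues ?G ! 0 * (u i \<bullet> v)\<^sup>2)"
    by (intro sum_mono mult_right_mono desc_eigenvalues_antimono)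
      (auto simp: symmetric_desc_eigenbasis(2)[OF G symmetric_gram])
  then show ?thesis
    unfolding gram_scalar_prod[OF X v, symmetric] eigenbasis_expansion[OF G u v] sum_distrib_left .
qed

lemma norm_mult_mat_le_spectral_norm:
  fixes X :: "real mat"
  assumes X: "X \<in> carrier_mat p q" and q: "0 < q"
    and v: "v \<in> carrier_vec q" "euclidean_norm v \<le> 1"
  shows "euclidean_norm (X *\<^sub>v v) \<le> spectral_norm X"
  unfolding spectral_norm_def
proof (rule cSUP_upper)
  let ?c = "desc_eigenvalues (transpose_mat X * X) ! 0"
  show "v \<in> {v \<in> carrier_vec (dim_col X). euclidean_norm v \<le> 1}" using v X by simp
  show "bdd_above ((\<lambda>v. euclidean_norm (X *\<^sub>v v)) ` {v \<in> carrier_vec (dim_col X). euclidean_norm v \<le> 1})"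
  proof (rule bdd_aboveI2[where M = "sqrt ?c"])
    fix w :: "real vec" assume "w \<in> {v \<in> carrier_vec (dim_col X). euclidean_norm v \<le> 1}"
    then have w: "w \<in> carrier_vec q" "w \<bullet> w \<le> 1" using X by (auto simp: euclidean_norm_def)
    have "(X *\<^sub>v w) \<bullet> (X *\<^sub>v w) \<le> ?c * (w \<bullet> w)"
      by (rule scalar_prod_mult_mat_le_largest[OF X q w(1)])
    also have "\<dots> \<le> ?c * 1" using w(2) gram_eigenvalue_nonneg[OF X q] by (intro mult_left_mono) auto
    finally show "euclidean_norm (X *\<^sub>v w) \<le> sqrt ?c" by (simp add: euclidean_norm_def)
  qed
qed

lemma scalar_prod_mult_mat_le:
  fixes X :: "real mat"
  assumes X: "X \<in> carrier_mat p q" and q: "0 < q" and v: "v \<in> carrier_vec q"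
  shows "(X *\<^sub>v v) \<bullet> (X *\<^sub>v v) \<le> (spectral_norm X)\<^sup>2 * (v \<bullet> v)"
proof (cases "v = 0\<^sub>v q")
  case True
  have "X *\<^sub>v 0\<^sub>v q = 0\<^sub>v p" using X by (auto intro!: eq_vecI)
  then show ?thesis using True by simp
next
  case False
  define r where "r = sqrt (v \<bullet> v)"
  have r: "0 < r" "r\<^sup>2 = v \<bullet> v" using scalar_prod_self_pos[OF v False] by (auto simp: r_def)
  define w where "w = (1 / r) \<cdot>\<^sub>v v"
  have w: "w \<in> carrier_vec q" using v by (simp add: w_def)
  have "w \<bullet> w = 1" using r v by (simp add: w_def power2_eq_square flip: r(2))
  then have "euclidean_norm (X *\<^sub>v w) \<le> spectral_norm X"
    by (intro norm_mult_mat_le_spectral_norm[OF X q w]) (simp add: euclidean_norm_def)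
  then have "(X *\<^sub>v w) \<bullet> (X *\<^sub>v w) \<le> (spectral_norm X)\<^sup>2"
    unfolding euclidean_norm_sq[symmetric] by (intro power_mono euclidean_norm_nonneg)
  moreover have "X *\<^sub>v w = (1 / r) \<cdot>\<^sub>v (X *\<^sub>v v)"
    unfolding w_def by (rule mult_mat_vec[OF X v])
  ultimately have "((X *\<^sub>v v) \<bullet> (X *\<^sub>v v)) / r\<^sup>2 \<le> (spectral_norm X)\<^sup>2"
    by (simp add: power2_eq_square)
  then show ?thesis using r(1) by (simp add: r(2)[symmetric] pos_divide_le_eq)
qed

text \<open>The transpose has no larger norm: with \<open>t = X^T v\<close>, Cauchy-Schwarz applied
  to \<open>t \<bullet> t = v \<bullet> X t\<close> and the bound for \<open>X\<close> at
  \<open>t\<close> leave a common factor \<open>t \<bullet> t\<close> to cancel.\<close>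

lemma scalar_prod_mult_transpose_le:
  fixes X :: "real mat"
  assumes X: "X \<in> carrier_mat p q" and q: "0 < q" and v: "v \<in> carrier_vec p"
  shows "(transpose_mat X *\<^sub>v v) \<bullet> (transpose_mat X *\<^sub>v v) \<le> (spectral_norm X)\<^sup>2 * (v \<bullet> v)"
proof -
  define t where "t = transpose_mat X *\<^sub>v v"
  have t: "t \<in> carrier_vec q" and Xt: "X *\<^sub>v t \<in> carrier_vec p" using X v by (auto simp: t_def)
  have "t \<bullet> t = v \<bullet> (X *\<^sub>v t)"
    using transpose_vec_mult_scalar[OF X t v] by (simp add: t_def)
  then have "(t \<bullet> t)\<^sup>2 \<le> (v \<bullet> v) * ((X *\<^sub>v t) \<bullet> (X *\<^sub>v t))"
    using Cauchy_Schwarz_vec[OF v Xt] by simp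
  also have "\<dots> \<le> (v \<bullet> v) * ((spectral_norm X)\<^sup>2 * (t \<bullet> t))"
    by (intro mult_left_mono scalar_prod_mult_mat_le[OF X q t] scalar_prod_self_nonneg)
  finally have "(t \<bullet> t) * (t \<bullet> t) \<le> ((spectral_norm X)\<^sup>2 * (v \<bullet> v)) * (t \<bullet> t)"
    by (simp add: power2_eq_square ac_simps)
  then show ?thesis
    using scalar_prod_self_nonneg[of t] scalar_prod_self_nonneg[of v]
    unfolding t_def[symmetric] by (cases "t \<bullet> t = 0") (auto simp: mult_le_cancel_right)
qed

text \<open>Every vector is stretched by exactly \<open>sqrt c\<close>, so any unit vector attains
  the supremum.\<close>

lemma spectral_norm_sq_of_isotropic:
  fixes X :: "real mat"
  assumes X: "X \<in> carrier_mat p q" and q: "0 < q"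
    and c: "\<And>v. v \<in> carrier_vec q \<Longrightarrow> (X *\<^sub>v v) \<bullet> (X *\<^sub>v v) = c * (v \<bullet> v)"
  shows "(spectral_norm X)\<^sup>2 = c"
proof -
  have c0: "0 \<le> c"
    using c[of "unit_vec q 0"] scalar_prod_self_nonneg[of "X *\<^sub>v unit_vec q 0"] q by simp
  have n: "euclidean_norm (X *\<^sub>v v) = sqrt c * euclidean_norm v" if "v \<in> carrier_vec q" for v
    by (simp add: euclidean_norm_def c[OF that] real_sqrt_mult)
  have "spectral_norm X = sqrt c"
    unfolding spectral_norm_def
  proof (rule cSup_eq_maximum)
    show "sqrt c \<in> (\<lambda>v. euclidean_norm (X *\<^sub>v v)) ` {v \<in> carrier_vec (dim_col X). euclidean_norm v \<le> 1}"
    proof (rule image_eqI)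
      show "sqrt c = euclidean_norm (X *\<^sub>v unit_vec q 0)"
        using q by (simp add: n) (simp add: euclidean_norm_def)
      show "unit_vec q 0 \<in> {v \<in> carrier_vec (dim_col X). euclidean_norm v \<le> 1}"
        using q X by (auto simp: euclidean_norm_def)
    qed
    show "y \<le> sqrt c"
      if "y \<in> (\<lambda>v. euclidean_norm (X *\<^sub>v v)) ` {v \<in> carrier_vec (dim_col X). euclidean_norm v \<le> 1}" for y
      using that X c0 by (auto simp: n intro!: mult_left_le)
  qed
  then show ?thesis using c0 by simp
qed

section \<open>Kronecker products of vectors and their images\<close>

definition kron_vec :: "real vec \<Rightarrow> real vec \<Rightarrow> real vec" where
  "kron_vec u v = vec (dim_vec u * dim_vec v) (\<lambda>r. u $ (r div dim_vec v) * v $ (r mod dim_vec v))"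

lemma kron_vec_carrier [simp]:
  "u \<in> carrier_vec a \<Longrightarrow> v \<in> carrier_vec b \<Longrightarrow> kron_vec u v \<in> carrier_vec (a * b)"
  by (auto simp: kron_vec_def)

lemma div_mod_less:
  fixes r a b :: nat
  assumes "r < a * b"
  shows "r div b < a" "r mod b < b"
  using assms by (auto simp: less_mult_imp_div_less intro!: mod_less_divisor gr0I)

text \<open>Quotient and remainder by \<open>b\<close> identify the flat index with pairs; this
  splits every sum over a Kronecker index.\<close>

lemma sum_div_mod:
  fixes f :: "nat \<Rightarrow> nat \<Rightarrow> 'a :: comm_monoid_add"
  shows "(\<Sum>r<a * b. f (r div b) (r mod b)) = (\<Sum>i<a. \<Sum>j<b. f i j)"
  unfolding sum.cartesian_product
  by (rule sum.reindex_bij_witness[of _ "\<lambda>(i, j). i * b + j" "\<lambda>r. (r div b, r mod b)"])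
    (auto simp: div_mod_less block_index_less)

lemma kron_vec_scalar_prod:
  assumes "u \<in> carrier_vec a" "v \<in> carrier_vec b" "u' \<in> carrier_vec a" "v' \<in> carrier_vec b"
  shows "kron_vec u v \<bullet> kron_vec u' v' = (u \<bullet> u') * (v \<bullet> v')"
proof -
  have "kron_vec u v \<bullet> kron_vec u' v' =
      (\<Sum>r<a * b. (u $ (r div b) * u' $ (r div b)) * (v $ (r mod b) * v' $ (r mod b)))"
    using assms by (simp add: kron_vec_def scalar_prod_vec ac_simps)
  also have "\<dots> = (\<Sum>i<a. \<Sum>j<b. (u $ i * u' $ i) * (v $ j * v' $ j))"
    by (rule sum_div_mod)
  also have "\<dots> = (\<Sum>i<a. u $ i * u' $ i) * (\<Sum>j<b. v $ j * v' $ j)"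
    by (simp add: sum_product)
  finally show ?thesis using assms by (simp add: scalar_prod_def atLeast0LessThan)
qed

lemma kronecker_mult_kron_vec:
  assumes A: "A \<in> carrier_mat a a'" and B: "B \<in> carrier_mat b b'"
    and u: "u \<in> carrier_vec a'" and v: "v \<in> carrier_vec b'"
  shows "(A \<otimes>\<^sub>K B) *\<^sub>v kron_vec u v = kron_vec (A *\<^sub>v u) (B *\<^sub>v v)"
proof (rule eq_vecI)
  fix r assume "r < dim_vec (kron_vec (A *\<^sub>v u) (B *\<^sub>v v))"
  then have r: "r < a * b" using A B by (simp add: kron_vec_def)
  note rr = div_mod_less[OF r]
  have "((A \<otimes>\<^sub>K B) *\<^sub>v kron_vec u v) $ r = (\<Sum>s<a' * b'.
      (A $$ (r div b, s div b') * u $ (s div b')) * (B $$ (r mod b, s mod b') * v $ (s mod b')))"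
    using A B u v r
    by (auto simp: kronecker_def kron_vec_def scalar_prod_def atLeast0LessThan intro!: sum.cong)
  also have "\<dots> = (\<Sum>i<a'. \<Sum>j<b'. (A $$ (r div b, i) * u $ i) * (B $$ (r mod b, j) * v $ j))"
    by (rule sum_div_mod)
  also have "\<dots> = (\<Sum>i<a'. A $$ (r div b, i) * u $ i) * (\<Sum>j<b'. B $$ (r mod b, j) * v $ j)"
    by (simp add: sum_product)
  also have "\<dots> = kron_vec (A *\<^sub>v u) (B *\<^sub>v v) $ r"
    using A B u v r rr by (simp add: kron_vec_def scalar_prod_def atLeast0LessThan)
  finally show "((A \<otimes>\<^sub>K B) *\<^sub>v kron_vec u v) $ r = kron_vec (A *\<^sub>v u) (B *\<^sub>v v) $ r" .
qed (use A B in \<open>auto simp: kron_vec_def\<close>)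

lemma transpose_kronecker: "transpose_mat (A \<otimes>\<^sub>K B) = transpose_mat A \<otimes>\<^sub>K transpose_mat B"
  by (rule eq_matI) (auto simp: kronecker_def div_mod_less)

text \<open>The mixed product rule, applied once to the transposes and once to \<open>A\<close> and
  \<open>B\<close>.\<close>

lemma kronecker_gram_mult_kron_vec:
  assumes A: "A \<in> carrier_mat a a'" and B: "B \<in> carrier_mat b b'"
    and u: "u \<in> carrier_vec a" and v: "v \<in> carrier_vec b"
  shows "((A \<otimes>\<^sub>K B) * transpose_mat (A \<otimes>\<^sub>K B)) *\<^sub>v kron_vec u v =
    kron_vec ((A * transpose_mat A) *\<^sub>v u) ((B * transpose_mat B) *\<^sub>v v)"
proof -
  have "((A \<otimes>\<^sub>K B) * transpose_mat (A \<otimes>\<^sub>K B)) *\<^sub>v kron_vec u v =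
      (A \<otimes>\<^sub>K B) *\<^sub>v ((transpose_mat A \<otimes>\<^sub>K transpose_mat B) *\<^sub>v kron_vec u v)"
    unfolding transpose_kronecker[symmetric]
    by (rule assoc_mult_mat_vec[of _ "a * b" "a' * b'" _ "a * b"]) (use A B u v in auto)
  also have "\<dots> = kron_vec (A *\<^sub>v (transpose_mat A *\<^sub>v u)) (B *\<^sub>v (transpose_mat B *\<^sub>v v))"
    using A B u v by (simp add: kronecker_mult_kron_vec[of _ a' a _ b' b]
        kronecker_mult_kron_vec[OF A B])
  finally show ?thesis
    using A B u v by (simp add: assoc_mult_mat_vec[of A a a' _ a] assoc_mult_mat_vec[of B b b' _ b])
qed

text \<open>Each row of the joined matrix is a concatenation, so inner products of rows add. This
  splits the NTK into the contributions of the two layers.\<close>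

lemma append_cols_gram:
  assumes A: "A \<in> carrier_mat m p" and B: "B \<in> carrier_mat m q"
  shows "append_cols A B * transpose_mat (append_cols A B) = A * transpose_mat A + B * transpose_mat B"
proof (rule eq_matI)
  let ?J = "append_cols A B"
  have J: "?J \<in> carrier_mat m (p + q)" using A B by (auto simp: append_cols_def)
  have row: "row ?J i = row A i @\<^sub>v row B i" if "i < m" for i
    using that A B by (intro eq_vecI) (auto simp: append_cols_def)
  fix i j assume "i < dim_row (A * transpose_mat A + B * transpose_mat B)"
    "j < dim_col (A * transpose_mat A + B * transpose_mat B)"
  then have ij: "i < m" "j < m" using B by auto
  then have "(?J * transpose_mat ?J) $$ (i, j) = row ?J i \<bullet> row ?J j"
    using J by simp
  also have "\<dots> = row A i \<bullet> row A j + row B i \<bullet> row B j"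
    unfolding row[OF ij(1)] row[OF ij(2)] using A B ij by (intro scalar_prod_append[of _ p _ q]) auto
  finally show "(?J * transpose_mat ?J) $$ (i, j)
      = (A * transpose_mat A + B * transpose_mat B) $$ (i, j)"
    using A B ij by simp
qed (use A B in \<open>auto simp: append_cols_def\<close>)

text \<open>The NTK acts as \<open>ntk_block X W1 s\<close> on the tensor product of an eigenvector of \<open>W2 W2\<^sup>T\<close> for
  the eigenvalue \<open>s\<close> with \<open>\<real>\<^sup>n\<close>.\<close>

definition ntk_block :: "real mat \<Rightarrow> real mat \<Rightarrow> real \<Rightarrow> real mat" where
  "ntk_block X W1 s = (1 / real (dim_row X)) \<cdot>\<^sub>m
     (s \<cdot>\<^sub>m (X * transpose_mat X) + (X * transpose_mat W1) * transpose_mat (X * transpose_mat W1))"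

lemma smult_mat_mult_vec:
  assumes "A \<in> carrier_mat n m" "v \<in> carrier_vec m"
  shows "(c \<cdot>\<^sub>m A) *\<^sub>v v = (c :: real) \<cdot>\<^sub>v (A *\<^sub>v v)"
  using assms by (intro eq_vecI) auto

context
  fixes n d0 d1 :: nat and X W1 :: "real mat"
  assumes X: "X \<in> carrier_mat n d0" and W1: "W1 \<in> carrier_mat d1 d0"
begin

lemma ntk_block_carrier: "ntk_block X W1 s \<in> carrier_mat n n"
proof -
  have "X * transpose_mat X \<in> carrier_mat n n"
    "(X * transpose_mat W1) * transpose_mat (X * transpose_mat W1) \<in> carrier_mat n n"
    using X W1 by auto
  then show ?thesis unfolding ntk_block_def by (intro smult_carrier_mat add_carrier_mat)
qed

lemma ntk_block_mult_vec:
  assumes v: "v \<in> carrier_vec n"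
  shows "ntk_block X W1 s *\<^sub>v v = (1 / real n) \<cdot>\<^sub>v (s \<cdot>\<^sub>v ((X * transpose_mat X) *\<^sub>v v) +
    ((X * transpose_mat W1) * transpose_mat (X * transpose_mat W1)) *\<^sub>v v)"
proof -
  let ?P = "X * transpose_mat X" and ?Q = "(X * transpose_mat W1) * transpose_mat (X * transpose_mat W1)"
  have P: "?P \<in> carrier_mat n n" and Q: "?Q \<in> carrier_mat n n" using X W1 by auto
  have "ntk_block X W1 s *\<^sub>v v = (1 / real n) \<cdot>\<^sub>v ((s \<cdot>\<^sub>m ?P + ?Q) *\<^sub>v v)"
    unfolding ntk_block_def using P Q v X by (subst smult_mat_mult_vec[of _ n n]) auto
  also have "(s \<cdot>\<^sub>m ?P + ?Q) *\<^sub>v v = (s \<cdot>\<^sub>m ?P) *\<^sub>v v + ?Q *\<^sub>v v"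
    by (rule add_mult_distrib_mat_vec[of _ n n]) (use P Q v in auto)
  also have "(s \<cdot>\<^sub>m ?P) *\<^sub>v v = s \<cdot>\<^sub>v (?P *\<^sub>v v)"
    by (rule smult_mat_mult_vec[OF P v])
  finally show ?thesis .
qed

lemma symmetric_ntk_block: "transpose_mat (ntk_block X W1 s) = ntk_block X W1 s"
proof -
  let ?P = "X * transpose_mat X" and ?Q = "(X * transpose_mat W1) * transpose_mat (X * transpose_mat W1)"
  have P: "?P \<in> carrier_mat n n" and Q: "?Q \<in> carrier_mat n n" using X W1 by auto
  have "transpose_mat (a \<cdot>\<^sub>m (s \<cdot>\<^sub>m A + B)) = a \<cdot>\<^sub>m (s \<cdot>\<^sub>m transpose_mat A + transpose_mat B)"
    if "A \<in> carrier_mat n n" "B \<in> carrier_mat n n" for a and A B :: "real mat"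
    using that by (intro eq_matI) auto
  from this[OF P Q] show ?thesis by (simp only: symmetric_gram' ntk_block_def)
qed

text \<open>Up to the factor \<open>1 / n\<close> this is the quadratic form of
  \<open>s + W1^T W1\<close> at \<open>t\<close>, which makes the block comparable with
  \<open>W1^T W1\<close> along the transpose of \<open>X\<close>.\<close>

lemma ntk_block_scalar_prod:
  assumes v: "v \<in> carrier_vec n"
  defines "t \<equiv> transpose_mat X *\<^sub>v v"
  shows "v \<bullet> (ntk_block X W1 s *\<^sub>v v) = (s * (t \<bullet> t) + (W1 *\<^sub>v t) \<bullet> (W1 *\<^sub>v t)) / real n"
proof -
  let ?Z = "X * transpose_mat W1"
  have X': "transpose_mat X \<in> carrier_mat d0 n" and Z: "?Z \<in> carrier_mat n d1"
    and Z': "transpose_mat ?Z \<in> carrier_mat d1 n"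
    using X W1 by auto
  have Zv: "transpose_mat ?Z *\<^sub>v v = W1 *\<^sub>v t"
    using X W1 v by (simp add: t_def transpose_mult[of X n d0 _ d1] assoc_mult_mat_vec[of W1 d1 d0 _ n])
  have "v \<bullet> ((X * transpose_mat X) *\<^sub>v v) = t \<bullet> t"
    using gram_scalar_prod[OF X' v] by (simp add: t_def)
  moreover have "v \<bullet> ((?Z * transpose_mat ?Z) *\<^sub>v v) = (W1 *\<^sub>v t) \<bullet> (W1 *\<^sub>v t)"
    using gram_scalar_prod[OF Z' v] by (simp only: Zv transpose_transpose)
  moreover have "(X * transpose_mat X) *\<^sub>v v \<in> carrier_vec n" "(?Z * transpose_mat ?Z) *\<^sub>v v \<in> carrier_vec n"
    using X Z v by (auto intro!: mult_mat_vec_carrier[of _ n n])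
  ultimately show ?thesis
    unfolding ntk_block_mult_vec[OF v] using v
    by (simp add: scalar_prod_add_distrib[of _ n] del: assoc_mult_mat_vec assoc_mult_mat)
qed

text \<open>The two layers contribute Kronecker products with first factors \<open>W2 W2^T\<close>
  and the identity. On \<open>u\<close> these act as the scalars \<open>s\<close> and 1, so
  \<open>u\<close> can be pulled out.\<close>

lemma ntk_mult_kron_vec:
  assumes W2: "W2 \<in> carrier_mat d2 d1" and u: "u \<in> carrier_vec d2" and v: "v \<in> carrier_vec n"
    and eig: "(W2 * transpose_mat W2) *\<^sub>v u = s \<cdot>\<^sub>v u"
  shows "ntk X W1 W2 *\<^sub>v kron_vec u v = kron_vec u (ntk_block X W1 s *\<^sub>v v)"
proof -
  let ?Z = "X * transpose_mat W1"
  let ?J1 = "W2 \<otimes>\<^sub>K X" and ?J2 = "1\<^sub>m d2 \<otimes>\<^sub>K ?Z"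
  define P Q where "P = X * transpose_mat X" and "Q = ?Z * transpose_mat ?Z"
  have P: "P \<in> carrier_mat n n" and Q: "Q \<in> carrier_mat n n" and Z: "?Z \<in> carrier_mat n d1"
    using X W1 by (auto simp: P_def Q_def)
  have J1: "?J1 \<in> carrier_mat (d2 * n) (d1 * d0)" and J2: "?J2 \<in> carrier_mat (d2 * n) (d2 * d1)"
    using X W1 W2 by auto
  have J11: "?J1 * transpose_mat ?J1 \<in> carrier_mat (d2 * n) (d2 * n)"
    and J22: "?J2 * transpose_mat ?J2 \<in> carrier_mat (d2 * n) (d2 * n)"
    using J1 J2 by auto
  have uv: "kron_vec u v \<in> carrier_vec (d2 * n)" using u v by simp
  have "ntk X W1 W2 = (1 / real n) \<cdot>\<^sub>m (?J1 * transpose_mat ?J1 + ?J2 * transpose_mat ?J2)"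
    using X W2 append_cols_gram[OF J1 J2] by (simp add: ntk_def net_jacobian_def)
  then have "ntk X W1 W2 *\<^sub>v kron_vec u v = (1 / real n) \<cdot>\<^sub>v
      ((?J1 * transpose_mat ?J1 + ?J2 * transpose_mat ?J2) *\<^sub>v kron_vec u v)"
    by (simp only: smult_mat_mult_vec[OF add_carrier_mat[OF J22] uv])
  also have "(?J1 * transpose_mat ?J1 + ?J2 * transpose_mat ?J2) *\<^sub>v kron_vec u v
      = (?J1 * transpose_mat ?J1) *\<^sub>v kron_vec u v + (?J2 * transpose_mat ?J2) *\<^sub>v kron_vec u v"
    by (rule add_mult_distrib_mat_vec[OF J11 J22 uv])
  also have "(?J1 * transpose_mat ?J1) *\<^sub>v kron_vec u v = kron_vec (s \<cdot>\<^sub>v u) (P *\<^sub>v v)"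
    unfolding kronecker_gram_mult_kron_vec[OF W2 X u v] eig P_def ..
  also have "(?J2 * transpose_mat ?J2) *\<^sub>v kron_vec u v = kron_vec u (Q *\<^sub>v v)"
    unfolding kronecker_gram_mult_kron_vec[OF one_carrier_mat Z u v] Q_def using u by simp
  also have "(1 / real n) \<cdot>\<^sub>v (kron_vec (s \<cdot>\<^sub>v u) (P *\<^sub>v v) + kron_vec u (Q *\<^sub>v v))
      = kron_vec u ((1 / real n) \<cdot>\<^sub>v (s \<cdot>\<^sub>v (P *\<^sub>v v) + Q *\<^sub>v v))"
    using P Q u v
    by (intro eq_vecI) (auto simp: kron_vec_def div_mod_less algebra_simps simp del: index_mult_mat_vec)
  finally show ?thesis unfolding ntk_block_mult_vec[OF v] P_def Q_def .
qed

end

section \<open>The spectrum of the NTK\<close>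

text \<open>An eigenbasis of the NTK consists of the products of each \<open>u j\<close> with an
  eigenbasis \<open>v j\<close> of its own block \<open>B j\<close>.\<close>

lemma eigenvalues_ntk:
  fixes X W1 W2 :: "real mat"
  assumes X: "X \<in> carrier_mat n d0" and W1: "W1 \<in> carrier_mat d1 d0" and W2: "W2 \<in> carrier_mat d2 d1"
  shows "eigenvalues (ntk X W1 W2) = image_mset
    (\<lambda>(i, j). desc_eigenvalues
      (ntk_block X W1 (desc_eigenvalues (W2 * transpose_mat W2) ! (j - 1))) ! (i - 1))
    (mset_set ({1..n} \<times> {1..d2}))"
proof -
  let ?G = "W2 * transpose_mat W2"
  define s where "s = (!) (desc_eigenvalues ?G)"
  define B where "B j = ntk_block X W1 (s j)" for j
  have G: "?G \<in> carrier_mat d2 d2" using W2 by simp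
  obtain u where u: "eigenbasis ?G d2 u s"
    using symmetric_desc_eigenbasis(1)[OF G symmetric_gram'] unfolding s_def by blast
  have "\<exists>v. eigenbasis (B j) n v ((!) (desc_eigenvalues (B j)))" for j
    unfolding B_def
    by (rule symmetric_desc_eigenbasis(1)[OF ntk_block_carrier[OF X W1] symmetric_ntk_block[OF X W1]])
  then obtain v where v: "eigenbasis (B j) n (v j) ((!) (desc_eigenvalues (B j)))" for j
    by metis
  \<comment> \<open>Position \<open>r = j * n + i\<close> stands for the \<open>i\<close>-th
    eigenvector of block \<open>j\<close>, both counted from 0.\<close>
  define f where "f r = desc_eigenvalues (B (r div n)) ! (r mod n)" for r
  have "eigenbasis (ntk X W1 W2) (d2 * n) (\<lambda>r. kron_vec (u (r div n)) (v (r div n) (r mod n))) f"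
    unfolding eigenbasis_def
  proof (intro conjI allI impI)
    fix r assume r: "r < d2 * n"
    note rr = div_mod_less[OF r]
    have ur: "u (r div n) \<in> carrier_vec d2" and vr: "v (r div n) (r mod n) \<in> carrier_vec n"
      using eigenbasisD(1)[OF u rr(1)] eigenbasisD(1)[OF v rr(2)] by auto
    show "kron_vec (u (r div n)) (v (r div n) (r mod n)) \<in> carrier_vec (d2 * n)"
      using ur vr by simp
    have "ntk X W1 W2 *\<^sub>v kron_vec (u (r div n)) (v (r div n) (r mod n))
        = kron_vec (u (r div n)) (B (r div n) *\<^sub>v v (r div n) (r mod n))"
      unfolding B_def by (rule ntk_mult_kron_vec[OF X W1 W2 ur vr eigenbasisD(2)[OF u rr(1)]])
    also have "\<dots> = f r \<cdot>\<^sub>v kron_vec (u (r div n)) (v (r div n) (r mod n))"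
      unfolding eigenbasisD(2)[OF v rr(2)] f_def
      by (intro eq_vecI) (auto simp: kron_vec_def div_mod_less)
    finally show "ntk X W1 W2 *\<^sub>v kron_vec (u (r div n)) (v (r div n) (r mod n))
        = f r \<cdot>\<^sub>v kron_vec (u (r div n)) (v (r div n) (r mod n))" .
    fix q assume q: "q < d2 * n"
    note qq = div_mod_less[OF q]
    have uq: "u (q div n) \<in> carrier_vec d2" and vq: "v (q div n) (q mod n) \<in> carrier_vec n"
      using eigenbasisD(1)[OF u qq(1)] eigenbasisD(1)[OF v qq(2)] by auto
    have rq: "r = q \<longleftrightarrow> r div n = q div n \<and> r mod n = q mod n"
      by (metis div_mult_mod_eq)
    show "kron_vec (u (r div n)) (v (r div n) (r mod n)) \<bullet> kron_vec (u (q div n)) (v (q div n) (q mod n))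
        = (if r = q then 1 else 0)"
      unfolding kron_vec_scalar_prod[OF ur vr uq vq] rq
      \<comment> \<open>Different blocks are separated by orthogonality of the \<open>u\<close>
        factors; within one block both \<open>v\<close> factors come from the same
        eigenbasis.\<close>
      using eigenbasisD(3)[OF u rr(1) qq(1)] eigenbasisD(3)[OF v rr(2) qq(2)]
      by (cases "r div n = q div n") auto
  qed
  then have "eigenvalues (ntk X W1 W2) = mset (map f [0..<d2 * n])"
    by (rule eigenvalues_eigenbasis[OF ntk_carrier[OF X W1 W2]])
  also have "\<dots> = image_mset f (mset_set {..<d2 * n})"
    by (simp add: atLeast0LessThan)
  also have "\<dots> = image_mset (\<lambda>(i, j). desc_eigenvalues (B (j - 1)) ! (i - 1))
      (image_mset (\<lambda>r. (Suc (r mod n), Suc (r div n))) (mset_set {..<d2 * n}))"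
    by (simp add: multiset.map_comp o_def f_def[abs_def])
  also have "image_mset (\<lambda>r. (Suc (r mod n), Suc (r div n))) (mset_set {..<d2 * n})
      = mset_set ((\<lambda>r. (Suc (r mod n), Suc (r div n))) ` {..<d2 * n})"
    by (rule image_mset_mset_set) (auto simp: inj_on_def, metis div_mult_mod_eq)
  also have "(\<lambda>r. (Suc (r mod n), Suc (r div n))) ` {..<d2 * n} = {1..n} \<times> {1..d2}"
  proof (intro equalityI subsetI)
    fix p assume "p \<in> {1..n} \<times> {1..d2}"
    then obtain i j where p: "p = (Suc i, Suc j)" "i < n" "j < d2"
      by (cases p; cases "fst p"; cases "snd p") auto
    then show "p \<in> (\<lambda>r. (Suc (r mod n), Suc (r div n))) ` {..<d2 * n}"
      by (intro image_eqI[of _ _ "j * n + i"]) (auto simp: block_index_less)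
  qed (auto simp: Suc_le_eq div_mod_less)
  finally show ?thesis by (simp add: B_def s_def)
qed

text \<open>Zeros are discarded on both sides, so the index set may be exchanged for any finite one
  on which \<open>f\<close> has the same non-zero support.\<close>

lemma eigenvalues_indexed_by_of_support:
  assumes "eigenvalues A = image_mset f (mset_set I)" "finite I" "finite I'"
    and "{x \<in> I. f x \<noteq> 0} = {x \<in> I'. f x \<noteq> 0}"
  shows "eigenvalues_indexed_by A f I'"
proof -
  have "{#e \<in># image_mset f (mset_set K). e \<noteq> 0#} = image_mset f (mset_set {x \<in> K. f x \<noteq> 0})"
    if "finite K" for K
    using that by (simp add: filter_mset_image_mset filter_mset_mset_set)
  then show ?thesis using assms by (simp add: eigenvalues_indexed_by_def)
qed

section \<open>Upper and lower eigenvalue bounds for one block\<close>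

context
  fixes n d0 d1 :: nat and X W1 :: "real mat" and s :: real
  assumes X: "X \<in> carrier_mat n d0" and W1: "W1 \<in> carrier_mat d1 d0" and s: "0 \<le> s"
begin

lemma ntk_block_eigenvalue_nonneg:
  assumes i: "i < n"
  shows "0 \<le> desc_eigenvalues (ntk_block X W1 s) ! i"
proof (rule psd_eigenvalue_nonneg[OF ntk_block_carrier[OF X W1] symmetric_ntk_block[OF X W1] _ i])
  show "0 \<le> x \<bullet> (ntk_block X W1 s *\<^sub>v x)" if "x \<in> carrier_vec n" for x
    unfolding ntk_block_scalar_prod[OF X W1 that]
    using s by (intro divide_nonneg_nonneg add_nonneg_nonneg mult_nonneg_nonneg scalar_prod_self_nonneg) auto
qed

text \<open>More than \<open>d0\<close> eigenvectors span a space on which \<open>X^T\<close> is not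
  injective, and the quadratic form of the block vanishes on the kernel of
  \<open>X^T\<close>.\<close>

lemma ntk_block_eigenvalue_eq_0:
  assumes i: "d0 \<le> i" "i < n"
  shows "desc_eigenvalues (ntk_block X W1 s) ! i = 0"
proof -
  let ?B = "ntk_block X W1 s"
  have X': "transpose_mat X \<in> carrier_mat d0 n" using X by simp
  obtain y where y: "y \<in> carrier_vec n" "0 < y \<bullet> y"
      "desc_eigenvalues ?B ! i * (y \<bullet> y) \<le> y \<bullet> (?B *\<^sub>v y)" "transpose_mat X *\<^sub>v y = 0\<^sub>v d0"
    using eigenvalue_interlacing[OF one_carrier_mat transpose_one
        ntk_block_carrier[OF X W1] symmetric_ntk_block[OF X W1] X' i(2)] i(1) by metis
  have "W1 *\<^sub>v 0\<^sub>v d0 = 0\<^sub>v d1" using W1 by (auto intro!: eq_vecI)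
  then have "desc_eigenvalues ?B ! i * (y \<bullet> y) \<le> 0"
    using y(3) unfolding ntk_block_scalar_prod[OF X W1 y(1)] y(4) by simp
  then have "desc_eigenvalues ?B ! i \<le> 0" using y(2) by (simp add: mult_le_0_iff)
  then show ?thesis using ntk_block_eigenvalue_nonneg[OF i(2)] by simp
qed

text \<open>Interlacing along \<open>X^T\<close> gives a \<open>y\<close> in the span of the top
  eigenvectors of the block whose image \<open>t\<close> satisfies
  \<open>(W1 t) \<bullet> (W1 t) \<le> \<mu> * (t \<bullet> t)\<close>. The spectral norm of
  \<open>X\<close> then bounds \<open>t \<bullet> t\<close> by \<open>y \<bullet> y\<close>, up to
  its square.\<close>

lemma ntk_block_eigenvalue_le:
  assumes i: "i < n" "i < d0"
  shows "desc_eigenvalues (ntk_block X W1 s) ! i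
    \<le> (spectral_norm X)\<^sup>2 / real n * (desc_eigenvalues (transpose_mat W1 * W1) ! i + s)"
proof -
  let ?B = "ntk_block X W1 s"
  define \<mu> where "\<mu> = desc_eigenvalues (transpose_mat W1 * W1) ! i"
  define \<alpha> where "\<alpha> = desc_eigenvalues ?B ! i"
  define c where "c = (spectral_norm X)\<^sup>2"
  have X': "transpose_mat X \<in> carrier_mat d0 n" and G: "transpose_mat W1 * W1 \<in> carrier_mat d0 d0"
    using X W1 by auto
  obtain y where y: "y \<in> carrier_vec n" "0 < y \<bullet> y" "\<alpha> * (y \<bullet> y) \<le> y \<bullet> (?B *\<^sub>v y)"
      "(transpose_mat X *\<^sub>v y) \<bullet> ((transpose_mat W1 * W1) *\<^sub>v (transpose_mat X *\<^sub>v y))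
        \<le> \<mu> * ((transpose_mat X *\<^sub>v y) \<bullet> (transpose_mat X *\<^sub>v y))"
    using eigenvalue_interlacing[OF G symmetric_gram
        ntk_block_carrier[OF X W1] symmetric_ntk_block[OF X W1] X' i(1)] i(2)
    unfolding \<mu>_def \<alpha>_def by metis
  define t where "t = transpose_mat X *\<^sub>v y"
  have t: "t \<in> carrier_vec d0" using X y(1) by (simp add: t_def)
  have \<mu>: "0 \<le> \<mu>" unfolding \<mu>_def by (rule gram_eigenvalue_nonneg[OF W1 i(2)])
  have tt: "t \<bullet> t \<le> c * (y \<bullet> y)"
    unfolding t_def c_def using i by (intro scalar_prod_mult_transpose_le[OF X _ y(1)]) simp
  have Wt: "(W1 *\<^sub>v t) \<bullet> (W1 *\<^sub>v t) \<le> \<mu> * (t \<bullet> t)"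
    using y(4) unfolding t_def[symmetric] gram_scalar_prod[OF W1 t] .
  have "\<alpha> * (y \<bullet> y) \<le> (s * (t \<bullet> t) + (W1 *\<^sub>v t) \<bullet> (W1 *\<^sub>v t)) / real n"
    using y(3) unfolding ntk_block_scalar_prod[OF X W1 y(1)] t_def .
  also have "\<dots> \<le> (s * (t \<bullet> t) + \<mu> * (t \<bullet> t)) / real n"
    using Wt by (intro divide_right_mono) auto
  also have "\<dots> = (s + \<mu>) / real n * (t \<bullet> t)" by (simp add: algebra_simps add_divide_distrib)
  also have "\<dots> \<le> (s + \<mu>) / real n * (c * (y \<bullet> y))"
    using tt s \<mu> by (intro mult_left_mono) auto
  also have "\<dots> = (c / real n * (\<mu> + s)) * (y \<bullet> y)" by (simp add: algebra_simps)
  finally have "\<alpha> \<le> c / real n * (\<mu> + s)" using y(2) by (rule mult_right_le_imp_le)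
  then show ?thesis unfolding \<mu>_def \<alpha>_def c_def .
qed

text \<open>Interlacing in the opposite direction, along \<open>X\<close>. Since
  \<open>X^T X\<close> is the scalar \<open>c\<close>, the quadratic form of the block at
  \<open>X y\<close> and the squared length of \<open>X y\<close> are known exactly; the factors are
  \<open>c * c / n\<close> and \<open>c\<close>, and one \<open>c\<close> cancels.\<close>

lemma ntk_block_eigenvalue_ge:
  assumes i: "i < d0" "d0 \<le> n"
    and c: "\<And>x. x \<in> carrier_vec d0 \<Longrightarrow> (transpose_mat X * X) *\<^sub>v x = c \<cdot>\<^sub>v x" "0 \<le> c"
  shows "c / real n * (desc_eigenvalues (transpose_mat W1 * W1) ! i + s)
    \<le> desc_eigenvalues (ntk_block X W1 s) ! i"
proof (cases "c = 0")
  \<comment> \<open>For \<open>c = 0\<close> the vector \<open>X y\<close> would vanish, but the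
    claim reduces to non-negativity of the eigenvalue.\<close>
  case True
  then show ?thesis using ntk_block_eigenvalue_nonneg i by simp
next
  case False
  let ?B = "ntk_block X W1 s"
  define \<mu> where "\<mu> = desc_eigenvalues (transpose_mat W1 * W1) ! i"
  define \<alpha> where "\<alpha> = desc_eigenvalues ?B ! i"
  have G: "transpose_mat W1 * W1 \<in> carrier_mat d0 d0" using W1 by auto
  have i': "i < n" using i by simp
  obtain y where y: "y \<in> carrier_vec d0" "0 < y \<bullet> y"
      "\<mu> * (y \<bullet> y) \<le> y \<bullet> ((transpose_mat W1 * W1) *\<^sub>v y)"
      "(X *\<^sub>v y) \<bullet> (?B *\<^sub>v (X *\<^sub>v y)) \<le> \<alpha> * ((X *\<^sub>v y) \<bullet> (X *\<^sub>v y))"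
    using eigenvalue_interlacing[OF ntk_block_carrier[OF X W1] symmetric_ntk_block[OF X W1]
        G symmetric_gram X i(1)] i' unfolding \<mu>_def \<alpha>_def by metis
  have Xy: "X *\<^sub>v y \<in> carrier_vec n" and Wy: "W1 *\<^sub>v y \<in> carrier_vec d1" using X W1 y(1) by auto
  have "transpose_mat X *\<^sub>v (X *\<^sub>v y) = (transpose_mat X * X) *\<^sub>v y"
    using X y(1) by (subst assoc_mult_mat_vec[of _ d0 n _ d0]) auto
  then have t: "transpose_mat X *\<^sub>v (X *\<^sub>v y) = c \<cdot>\<^sub>v y" by (simp only: c(1)[OF y(1)])
  have XX: "(X *\<^sub>v y) \<bullet> (X *\<^sub>v y) = c * (y \<bullet> y)"
    unfolding mult_mat_vec_scalar_prod[OF X y(1) y(1)] t using y(1) by simp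
  have W: "W1 *\<^sub>v (c \<cdot>\<^sub>v y) = c \<cdot>\<^sub>v (W1 *\<^sub>v y)" by (rule mult_mat_vec[OF W1 y(1)])
  have "\<mu> * (y \<bullet> y) \<le> (W1 *\<^sub>v y) \<bullet> (W1 *\<^sub>v y)" using y(3) unfolding gram_scalar_prod[OF W1 y(1)] .
  then have "c * c / real n * (s * (y \<bullet> y) + \<mu> * (y \<bullet> y))
      \<le> c * c / real n * (s * (y \<bullet> y) + (W1 *\<^sub>v y) \<bullet> (W1 *\<^sub>v y))"
    by (intro mult_left_mono) auto
  also have "\<dots> = (X *\<^sub>v y) \<bullet> (?B *\<^sub>v (X *\<^sub>v y))"
    unfolding ntk_block_scalar_prod[OF X W1 Xy] t W using y(1) Wy by (simp add: algebra_simps add_divide_distrib)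
  also have "\<dots> \<le> \<alpha> * (c * (y \<bullet> y))" using y(4) unfolding XX .
  finally have "(c / real n * (\<mu> + s)) * (c * (y \<bullet> y)) \<le> \<alpha> * (c * (y \<bullet> y))"
    by (simp add: algebra_simps add_divide_distrib)
  moreover have "0 < c * (y \<bullet> y)" using y(2) False c(2) by simp
  ultimately have "c / real n * (\<mu> + s) \<le> \<alpha>" by (rule mult_right_le_imp_le)
  then show ?thesis unfolding \<mu>_def \<alpha>_def .
qed

end

text \<open>All eigenvalues of \<open>X^T X\<close> equal one number \<open>c\<close>, so it acts as
  a scalar; the common stretching factor then identifies \<open>c\<close> with the squared spectral
  norm.\<close>

lemma equal_singular_values_isotropic:
  fixes X :: "real mat"
  assumes X: "X \<in> carrier_mat n d0" and d0: "0 < d0"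
    and eq: "\<forall>i \<in> {1..d0}. \<forall>j \<in> {1..d0}. singular_value i X = singular_value j X"
    and x: "x \<in> carrier_vec d0"
  shows "(transpose_mat X * X) *\<^sub>v x = (spectral_norm X)\<^sup>2 \<cdot>\<^sub>v x"
proof -
  let ?G = "transpose_mat X * X"
  define c where "c = desc_eigenvalues ?G ! 0"
  have G: "?G \<in> carrier_mat d0 d0" using X by simp
  obtain u where u: "eigenbasis ?G d0 u ((!) (desc_eigenvalues ?G))"
    using symmetric_desc_eigenbasis(1)[OF G symmetric_gram] by blast
  have "desc_eigenvalues ?G ! i = c" if "i < d0" for i
    unfolding c_def singular_value_sq[OF X that, symmetric] singular_value_sq[OF X d0, symmetric]
    using eq[rule_format, of "Suc i" "Suc 0"] that by simp
  then have Gx: "?G *\<^sub>v x = c \<cdot>\<^sub>v x" if "x \<in> carrier_vec d0" for x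
    by (rule eigenbasis_single_eigenvalue[OF G symmetric_gram u _ that])
  have "(spectral_norm X)\<^sup>2 = c"
  proof (rule spectral_norm_sq_of_isotropic[OF X d0])
    show "(X *\<^sub>v v) \<bullet> (X *\<^sub>v v) = c * (v \<bullet> v)" if "v \<in> carrier_vec d0" for v
      unfolding gram_scalar_prod[OF X that, symmetric] Gx[OF that] using that by simp
  qed
  then show ?thesis using Gx[OF x] by simp
qed

(* The pairs with i > d1 or j > d1 (where one singular value is 0 by convention) can carry
   non-zero eigenvalues: for X = W1 = (1) and W2 = (1, 0)^T the NTK is diag(2, 1).  So the index
   set cut off at min d0 d1 and min d1 d2 needs min n d0 <= d1 and d2 <= d1. *)
theorem theorem1:
  fixes n d0 d1 d2 :: nat and X W1 W2 :: "real mat"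
  assumes "0 < n" "0 < d0" "0 < d1" "0 < d2"
    and "X \<in> carrier_mat n d0"
    and "W1 \<in> carrier_mat d1 d0"
    and "W2 \<in> carrier_mat d2 d1"
  shows "\<exists>lam :: nat \<Rightarrow> nat \<Rightarrow> real.
    eigenvalues_indexed_by (ntk X W1 W2) (\<lambda>(i, j). lam i j) ({1..d0} \<times> {1..d2}) \<and>
    (min n d0 \<le> d1 \<and> d2 \<le> d1 \<longrightarrow>
      eigenvalues_indexed_by (ntk X W1 W2) (\<lambda>(i, j). lam i j)
        ({1..min d0 d1} \<times> {1..min d1 d2})) \<and>
    (\<forall>i \<in> {1..d0}. \<forall>j \<in> {1..d2}.
      lam i j \<le> (spectral_norm X)\<^sup>2 / real n *
        ((singular_value i W1)\<^sup>2 + (singular_value j W2)\<^sup>2)) \<and>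
    (d0 \<le> n \<and> vec_space.rank n X = d0 \<and>
      (\<forall>i \<in> {1..d0}. \<forall>j \<in> {1..d0}. singular_value i X = singular_value j X) \<longrightarrow>
      (\<forall>i \<in> {1..d0}. \<forall>j \<in> {1..d2}.
        lam i j = (spectral_norm X)\<^sup>2 / real n *
          ((singular_value i W1)\<^sup>2 + (singular_value j W2)\<^sup>2)))"
proof -
  note X = assms(5) and W1 = assms(6) and W2 = assms(7)
  define s where "s j = desc_eigenvalues (W2 * transpose_mat W2) ! (j - 1)" for j
  define c where "c = (spectral_norm X)\<^sup>2"
  \<comment> \<open>A block has only \<open>n\<close> eigenvalues; the default 0 fills the indices
    beyond them when \<open>n < d0\<close>.\<close>
  define lam where "lam i j = (if i \<le> n then desc_eigenvalues (ntk_block X W1 (s j)) ! (i - 1) else 0)"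
    for i j
  have sW2: "(singular_value j W2)\<^sup>2 = s j" if "j \<in> {1..d2}" for j
    using that singular_value_sq'[OF W2, of "j - 1"] by (auto simp: s_def)
  have s0: "0 \<le> s j" if "j \<in> {1..d2}" for j
    using sW2[OF that] zero_le_power2[of "singular_value j W2"] by simp
  have sW1: "(singular_value i W1)\<^sup>2 = desc_eigenvalues (transpose_mat W1 * W1) ! (i - 1)"
    if "i \<in> {1..d0}" for i
    using that singular_value_sq[OF W1, of "i - 1"] by auto
  have lam0: "lam i j = 0" if "d0 < i \<or> n < i" "j \<in> {1..d2}" for i j
    using that ntk_block_eigenvalue_eq_0[OF X W1 s0[OF that(2)], of "i - 1"] by (auto simp: lam_def)
  have le: "lam i j \<le> c / real n * ((singular_value i W1)\<^sup>2 + (singular_value j W2)\<^sup>2)"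
    if "i \<in> {1..d0}" "j \<in> {1..d2}" for i j
  proof (cases "i \<le> n")
    case True
    then show ?thesis
      unfolding sW2[OF that(2)] sW1[OF that(1)] c_def lam_def
      using ntk_block_eigenvalue_le[OF X W1 s0[OF that(2)], of "i - 1"] that(1) by auto
  \<comment> \<open>For \<open>i > n\<close> the default 0 lies below the non-negative right-hand
    side.\<close>
  qed (simp add: lam_def c_def)
  have ge: "c / real n * ((singular_value i W1)\<^sup>2 + (singular_value j W2)\<^sup>2) \<le> lam i j"
    if "i \<in> {1..d0}" "j \<in> {1..d2}" "d0 \<le> n"
      and eq: "\<forall>i \<in> {1..d0}. \<forall>j \<in> {1..d0}. singular_value i X = singular_value j X" for i j
    unfolding sW2[OF that(2)] sW1[OF that(1)] lam_def c_def
    using ntk_block_eigenvalue_ge[OF X W1 s0[OF that(2)] _ that(3)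
        equal_singular_values_isotropic[OF X assms(2) eq], of "i - 1"] that(1,3) by auto
  have ev: "eigenvalues (ntk X W1 W2) = image_mset (\<lambda>(i, j). lam i j) (mset_set ({1..n} \<times> {1..d2}))"
    unfolding eigenvalues_ntk[OF X W1 W2]
    by (rule image_mset_cong) (auto simp: lam_def s_def)
  \<comment> \<open>By \<open>lam0\<close> every non-zero value has \<open>i \<le> min n d0\<close>,
    so each larger cut-off \<open>p\<close> keeps them all. This covers both index sets of the
    claim.\<close>
  have indexed: "eigenvalues_indexed_by (ntk X W1 W2) (\<lambda>(i, j). lam i j) ({1..p} \<times> {1..d2})"
    if p: "min n d0 \<le> p" for p
  proof (rule eigenvalues_indexed_by_of_support[OF ev])
    show "{x \<in> {1..n} \<times> {1..d2}. (case x of (i, j) \<Rightarrow> lam i j) \<noteq> 0}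
        = {x \<in> {1..p} \<times> {1..d2}. (case x of (i, j) \<Rightarrow> lam i j) \<noteq> 0}"
    proof (rule Set.set_eqI)
      fix x :: "nat \<times> nat"
      obtain i j where x: "x = (i, j)" by (cases x)
      have "i \<le> d0 \<and> i \<le> n" if "lam i j \<noteq> 0" "j \<in> {1..d2}"
        using lam0[of i j] that by linarith
      then show "x \<in> {x \<in> {1..n} \<times> {1..d2}. (case x of (i, j) \<Rightarrow> lam i j) \<noteq> 0}
          \<longleftrightarrow> x \<in> {x \<in> {1..p} \<times> {1..d2}. (case x of (i, j) \<Rightarrow> lam i j) \<noteq> 0}"
        using p by (auto simp: x)
    qed
  qed auto
  show ?thesis
  proof (intro exI[of _ lam] conjI impI ballI)
    show "eigenvalues_indexed_by (ntk X W1 W2) (\<lambda>(i, j). lam i j) ({1..d0} \<times> {1..d2})"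
      by (rule indexed) simp
    show "eigenvalues_indexed_by (ntk X W1 W2) (\<lambda>(i, j). lam i j)
        ({1..min d0 d1} \<times> {1..min d1 d2})" if "min n d0 \<le> d1 \<and> d2 \<le> d1"
      \<comment> \<open>The assumption gives \<open>min n d0 \<le> min d0 d1\<close>, and
        \<open>min d1 d2\<close> is \<open>d2\<close>.\<close>
      using indexed[of "min d0 d1"] that by (simp add: min_absorb2)
  next
    fix i j assume ij: "i \<in> {1..d0}" "j \<in> {1..d2}"
    show "lam i j \<le> (spectral_norm X)\<^sup>2 / real n *
        ((singular_value i W1)\<^sup>2 + (singular_value j W2)\<^sup>2)"
      using le[OF ij] unfolding c_def .
    assume tight: "d0 \<le> n \<and> vec_space.rank n X = d0 \<and>
      (\<forall>i \<in> {1..d0}. \<forall>j \<in> {1..d0}. singular_value i X = singular_value j X)"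
    show "lam i j = (spectral_norm X)\<^sup>2 / real n *
        ((singular_value i W1)\<^sup>2 + (singular_value j W2)\<^sup>2)"
      unfolding c_def[symmetric]
      by (rule antisym[OF le[OF ij] ge[OF ij conjunct1[OF tight] conjunct2[OF conjunct2[OF tight]]]])
  qed
qed

end
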